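(* Let $K\subset\mathbf V^*$ be a nonempty convex compact set, let $f:\mathbf V^*\to\mathbb R$ be convex and $L$-smooth with respect to $\|\cdot\|_*$, let $x_0\in K$, and let $x_\star\in\arg\min_{x\in K}f(x)$. Let $\rho_{\|\cdot\|_*}>0$ be a constant depending only on the norm such that the stochastic gradients of the Parallel Frank-Wolfe algorithm described in the context satisfy, for every $k$, $$\mathbb E_k\Big\|\frac1m\sum_{i=1}^m g_{k,i}-\nabla G(v_k)\Big\|_*^2\le\frac{4R_K^2\rho_{\|\cdot\|_*}}{m},\qquad\text{where } G(y)=s_\alpha(-y).$$ Let $\epsilon>0$ and run the algorithm with $m\ge1$ parallel computing units and $$\alpha=\min\left\{\frac{\epsilon}{3s_1(0)},\ \frac{M\epsilon^2m^2}{36LR_K^3\rho_{\|\cdot\|_*}^2}\right\},$$ assuming $\frac{R_KM}{\alpha}\ge\frac1L$. Then an $\epsilon$ primal-dual gap is achieved, i.e. $\mathbb E[f(x_k)-d(y_k)]\le\epsilon$, for every number of iterations $k\ge1$ satisfying $$k\ge1+\frac{8\sqrt{LR_KM}}{\sqrt\alpha}\log\left(\frac{6LR_KM(f(x_0)-f(x_\star))}{\epsilon\alpha}\right).$$ The iteration complexity for reaching an $\epsilon$ primal-dual gap is therefore $\tilde O\left(\max\left(\frac1{\sqrt\epsilon},\frac1{\epsilon m}\right)\right)$.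
   Context: $\mathbf V$ is a real finite-dimensional vector space with norm $\|\cdot\|$, $\mathbf V^*$ its dual space, $\langle\cdot,\cdot\rangle:\mathbf V^*\times\mathbf V\to\mathbb R$ the dual pairing, and $\|z\|_*=\sup_{\|x\|\le1}\langle z,x\rangle$ the dual norm. $f$ is $L$-smooth w.r.t. $\|\cdot\|_*$ ($L>0$) if it is differentiable, with $\nabla f(x)\in\mathbf V$ and $\|\nabla f(x)-\nabla f(x')\|\le L\|x-x'\|_*$ for all $x,x'\in\mathbf V^*$. $f^*(y)=\sup_{x\in\mathbf V^*}\langle x,y\rangle-f(x)$ is the convex conjugate. $s(y)=\sup_{x\in K}\langle x,y\rangle$ is the support function of $K$. The dual objective of $\min_{x\in K}f(x)$ is $d(y)=-s(-y)-f^*(y)$, $y\in\mathbf V$. $R_K=\max_{x\in K}\|x\|_*$. $\Delta$ is a random variable in $\mathbf V$ with positive differentiable density $d\pi(z)\propto\exp(-\eta(z))\,dz$, and $M^2=\mathbb E\|\nabla\eta(\Delta)\|_*^2$; $R_K>0$ and $0<M<\infty$. For $\alpha>0$ the smoothed support function is $s_\alpha(y)=\mathbb E_\Delta[s(y+\alpha\Delta)]=\mathbb E_\Delta[\sup_{x\in K}\langle x,y+\alpha\Delta\rangle]$; in particular $s_1(0)=\mathbb E_\Delta[\sup_{x\in K}\langle x,\Delta\rangle]$, taken to be positive so that the choice $\alpha=\min\left\{\frac{\epsilon}{3s_1(0)},\ \frac{M\epsilon^2m^2}{36LR_K^3\rho_{\|\cdot\|_*}^2}\right\}$ makes sense. Standing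 properties of $s_\alpha$: it is convex, $\frac{R_KM}{\alpha}$-smooth w.r.t. $\|\cdot\|$ (i.e. $\|\nabla s_\alpha(y)-\nabla s_\alpha(y')\|_*\le\frac{R_KM}{\alpha}\|y-y'\|$), and for all $y\in\mathbf V$, $\nabla s_\alpha(y)=\mathbb E_\Delta[\arg\max_{x\in K}\langle x,y+\alpha\Delta\rangle]$ and $s(y)\le s_\alpha(y)\le s(y)+\alpha s_1(0)$. Parallel Frank-Wolfe algorithm. Set $A_0=0$, $d_0=0\in\mathbf V^*$, $\beta=\frac{R_KM}{\alpha}$, $\mu=\frac1L$, $y_0=\nabla f(x_0)$. For $k=0,1,2,\dots$: $$A_{k+1}=\frac{A_k(\mu+2\beta+\sqrt{\mu\beta})+\beta\mu+\sqrt{\mu^2(\beta+A_k)^2+4A_k\beta^2\mu+5A_k^2\mu\beta+2A_k\mu\sqrt{\mu\beta}\,(\beta+A_k)}}{2(\beta+\sqrt{\mu\beta})},$$ $\tau_k=1-\frac{A_k}{A_{k+1}}$; $v_k=(1-\tau_k)y_k+\tau_k\nabla f(x_k)$; for $i=1,\dots,m$ sample independently (of each other and of the past) $\Delta_i\sim d\pi$ and compute $g_{k,i}=-\arg\max_{u\in K}\langle u,-v_k+\alpha\Delta_i\rangle$; $g_k=\frac1m\sum_{i=1}^m g_{k,i}$; $d_{k+1}=d_k+(A_{k+1}-A_k)g_k$; $x_{k+1}=\frac{\beta}{A_{k+1}+\beta}x_0-\frac{1}{A_{k+1}+\beta}d_{k+1}$; $y_{k+1}=(1-\tau_k)y_k+\tau_k\nabla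 f(x_{k+1})$. (The vectors $d_k\in\mathbf V^*$ of the algorithm are unrelated to the dual function $d(\cdot)$.) $\mathbb E_k$ is expectation at iteration $k$ conditioned on the previous iterations; $\mathbb E$ is total expectation. $\log 0$ is read as $-\infty$. $\tilde O$ is as $\epsilon\to0$, hiding logarithmic factors in $1/\epsilon$ and constants depending only on $L,R_K,M,\rho_{\|\cdot\|_*},s_1(0)$ and $f(x_0)-f(x_\star)$ (not on $m$ or $\epsilon$). *)

theory Defs
  imports "HOL-Probability.Probability"
begin

text \<open>
  A finite-dimensional real space \<open>V\<close> is modelled by a type of class
  \<^class>\<open>euclidean_space\<close> with an arbitrary norm \<open>N\<close> on it. A functional
  in the dual of \<open>V\<close> is represented by the unique vector \<open>z\<close> with pairing
  \<open>\<langle>z, x\<rangle> = z \<bullet> x\<close>, so \<open>V\<close> and its dual share the carrier type and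
  differ by their norms, \<open>N\<close> and \<open>dual_norm N\<close>. The class norm only serves for the
  (norm-independent) topology and the choice of a Lebesgue measure.
\<close>

definition is_norm :: "('a::real_vector \<Rightarrow> real) \<Rightarrow> bool" where
  "is_norm N \<longleftrightarrow>
     (\<forall>x. N x = 0 \<longleftrightarrow> x = 0) \<and>
     (\<forall>x y. N (x + y) \<le> N x + N y) \<and>
     (\<forall>c x. N (c *\<^sub>R x) = \<bar>c\<bar> * N x)"

definition dual_norm :: "('a::real_inner \<Rightarrow> real) \<Rightarrow> 'a \<Rightarrow> real" where
  "dual_norm N z = (SUP x\<in>{x. N x \<le> 1}. z \<bullet> x)"

definition grad :: "('a::real_inner \<Rightarrow> real) \<Rightarrow> 'a \<Rightarrow> 'a" where
  "grad h x = (THE D. GDERIV h x :> D)"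

text \<open>\<open>N\<close> measures displacements of the argument, \<open>N'\<close> measures gradients.\<close>

definition smooth_wrt ::
    "('a::real_inner \<Rightarrow> real) \<Rightarrow> ('a \<Rightarrow> real) \<Rightarrow> real \<Rightarrow> ('a \<Rightarrow> real) \<Rightarrow> bool" where
  "smooth_wrt N N' C h \<longleftrightarrow>
     (\<forall>x. h differentiable (at x)) \<and>
     (\<forall>x x'. N' (grad h x - grad h x') \<le> C * N (x - x'))"

text \<open>The conjugate can be infinite, hence the extended reals.\<close>

definition conjugate :: "('a::real_inner \<Rightarrow> real) \<Rightarrow> 'a \<Rightarrow> ereal" where
  "conjugate h y = (SUP x. ereal (x \<bullet> y - h x))"

definition support_fun :: "'a::real_inner set \<Rightarrow> 'a \<Rightarrow> real" where
  "support_fun K y = (SUP x\<in>K. x \<bullet> y)"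

definition dual_obj :: "'a::real_inner set \<Rightarrow> ('a \<Rightarrow> real) \<Rightarrow> 'a \<Rightarrow> ereal" where
  "dual_obj K h y = - ereal (support_fun K (- y)) - conjugate h y"

definition noise :: "('a::euclidean_space \<Rightarrow> real) \<Rightarrow> 'a measure" where
  "noise \<eta> = density lborel
     (\<lambda>z. ennreal (exp (- \<eta> z) / (\<integral>u. exp (- \<eta> u) \<partial>lborel)))"

definition smoothed_support ::
    "'a::euclidean_space set \<Rightarrow> ('a \<Rightarrow> real) \<Rightarrow> real \<Rightarrow> 'a \<Rightarrow> real" where
  "smoothed_support K \<eta> \<alpha> y = (\<integral>z. support_fun K (y + \<alpha> *\<^sub>R z) \<partial>noise \<eta>)"

definition dual_radius :: "('a::real_inner \<Rightarrow> real) \<Rightarrow> 'a set \<Rightarrow> real" where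
  "dual_radius N K = (SUP x\<in>K. dual_norm N x)"

definition noise_const :: "('a::euclidean_space \<Rightarrow> real) \<Rightarrow> ('a \<Rightarrow> real) \<Rightarrow> real" where
  "noise_const N \<eta> = sqrt (\<integral>z. (dual_norm N (grad \<eta> z))\<^sup>2 \<partial>noise \<eta>)"

definition smoothing_param ::
    "real \<Rightarrow> real \<Rightarrow> real \<Rightarrow> real \<Rightarrow> real \<Rightarrow> nat \<Rightarrow> real \<Rightarrow> real" where
  "smoothing_param L R M s1 \<rho> m \<epsilon> =
     min (\<epsilon> / (3 * s1)) (M * \<epsilon>\<^sup>2 * (real m)\<^sup>2 / (36 * L * R ^ 3 * \<rho>\<^sup>2))"

text \<open>
  Here \<open>D\<close> is the initial primal suboptimality. For \<open>D = 0\<close> the library's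
  \<open>ln 0 = 0\<close> makes the threshold \<open>1\<close>; for \<open>k \<ge> 1\<close> this is the same condition
  as with the convention \<open>log 0 = -\<infinity>\<close>, namely no condition.
\<close>

definition iteration_threshold ::
    "real \<Rightarrow> real \<Rightarrow> real \<Rightarrow> real \<Rightarrow> real \<Rightarrow> real \<Rightarrow> nat \<Rightarrow> real \<Rightarrow> real" where
  "iteration_threshold L R M s1 \<rho> D m \<epsilon> =
     (let \<alpha> = smoothing_param L R M s1 \<rho> m \<epsilon> in
      1 + 8 * sqrt (L * R * M) / sqrt \<alpha> * ln (6 * L * R * M * D / (\<epsilon> * \<alpha>)))"

primrec weight_seq :: "real \<Rightarrow> real \<Rightarrow> nat \<Rightarrow> real" where
  "weight_seq \<mu> \<beta> 0 = 0"
| "weight_seq \<mu> \<beta> (Suc k) =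
     (let A = weight_seq \<mu> \<beta> k; r = sqrt (\<mu> * \<beta>) in
      (A * (\<mu> + 2 * \<beta> + r) + \<beta> * \<mu>
       + sqrt (\<mu>\<^sup>2 * (\<beta> + A)\<^sup>2 + 4 * A * \<beta>\<^sup>2 * \<mu> + 5 * A\<^sup>2 * \<mu> * \<beta> + 2 * A * \<mu> * r * (\<beta> + A)))
      / (2 * (\<beta> + r)))"

text \<open>
  \<open>lmo w\<close> is the selected maximiser of \<open>u \<bullet> w\<close> over \<open>u \<in> K\<close>, and
  \<open>\<Delta> k i\<close> is the \<open>i\<close>-th perturbation drawn at iteration \<open>k\<close>.
\<close>

locale parallel_fw_data =
  fixes N :: "'a::euclidean_space \<Rightarrow> real"
    and K :: "'a set"
    and f :: "'a \<Rightarrow> real"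
    and L :: real
    and x0 :: 'a
    and \<eta> :: "'a \<Rightarrow> real"
    and lmo :: "'a \<Rightarrow> 'a"
    and \<rho> :: real
    and m :: nat
    and \<epsilon> :: real
    and \<Delta> :: "nat \<Rightarrow> nat \<Rightarrow> 'w \<Rightarrow> 'a"
begin

definition R where "R = dual_radius N K"
definition M where "M = noise_const N \<eta>"
definition s1 where "s1 = smoothed_support K \<eta> 1 0"
definition \<alpha> where "\<alpha> = smoothing_param L R M s1 \<rho> m \<epsilon>"
definition \<beta> where "\<beta> = R * M / \<alpha>"
definition \<mu> where "\<mu> = 1 / L"
definition A where "A k = weight_seq \<mu> \<beta> k"
definition \<tau> where "\<tau> k = 1 - A k / A (Suc k)"

definition extrapolate :: "nat \<Rightarrow> 'a \<Rightarrow> 'a \<Rightarrow> 'a" where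
  "extrapolate k x y = (1 - \<tau> k) *\<^sub>R y + \<tau> k *\<^sub>R grad f x"

definition oracle_mean :: "nat \<Rightarrow> 'a \<Rightarrow> 'w \<Rightarrow> 'a" where
  "oracle_mean k v \<omega> = (1 / real m) *\<^sub>R (\<Sum>i=1..m. - lmo (- v + \<alpha> *\<^sub>R \<Delta> k i \<omega>))"

text \<open>The state is the triple \<open>(d\<^sub>k, x\<^sub>k, y\<^sub>k)\<close>.\<close>

primrec state :: "nat \<Rightarrow> 'w \<Rightarrow> 'a \<times> 'a \<times> 'a" where
  "state 0 = (\<lambda>\<omega>. (0, x0, grad f x0))"
| "state (Suc k) = (\<lambda>\<omega>.
     let (d, x, y) = state k \<omega>;
         g = oracle_mean k (extrapolate k x y) \<omega>;
         d' = d + (A (Suc k) - A k) *\<^sub>R g;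
         x' = (\<beta> / (A (Suc k) + \<beta>)) *\<^sub>R x0 - (1 / (A (Suc k) + \<beta>)) *\<^sub>R d';
         y' = (1 - \<tau> k) *\<^sub>R y + \<tau> k *\<^sub>R grad f x'
     in (d', x', y'))"

definition x :: "nat \<Rightarrow> 'w \<Rightarrow> 'a" where "x k \<omega> = fst (snd (state k \<omega>))"
definition y :: "nat \<Rightarrow> 'w \<Rightarrow> 'a" where "y k \<omega> = snd (snd (state k \<omega>))"
definition v :: "nat \<Rightarrow> 'w \<Rightarrow> 'a" where "v k \<omega> = extrapolate k (x k \<omega>) (y k \<omega>)"
definition g :: "nat \<Rightarrow> 'w \<Rightarrow> 'a" where "g k \<omega> = oracle_mean k (v k \<omega>) \<omega>"

definition G :: "'a \<Rightarrow> real" where "G w = smoothed_support K \<eta> \<alpha> (- w)"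

definition past :: "'w measure \<Rightarrow> nat \<Rightarrow> 'w measure" where
  "past P k = sigma (space P)
     {\<Delta> j i -` B \<inter> space P | j i B. j < k \<and> i \<in> {1..m} \<and> B \<in> sets borel}"

text \<open>
  Integrability is stated because the Bochner integral of a non-integrable
  function is \<open>0\<close>; finiteness of the dual objective because \<open>real_of_ereal\<close>
  maps infinite values to \<open>0\<close>.
\<close>

definition gap_achieved :: "'w measure \<Rightarrow> nat \<Rightarrow> bool" where
  "gap_achieved P k \<longleftrightarrow>
     (AE \<omega> in P. \<bar>dual_obj K f (y k \<omega>)\<bar> \<noteq> \<infinity>) \<and>
     integrable P (\<lambda>\<omega>. f (x k \<omega>) - real_of_ereal (dual_obj K f (y k \<omega>))) \<and>
     (\<integral>\<omega>. f (x k \<omega>) - real_of_ereal (dual_obj K f (y k \<omega>)) \<partial>P) \<le> \<epsilon>"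

end

locale parallel_fw =
  parallel_fw_data N K f L x0 \<eta> lmo \<rho> m \<epsilon> \<Delta> + prob_space P
  for N :: "'a::euclidean_space \<Rightarrow> real"
    and K f L x0 \<eta> lmo \<rho> m \<epsilon>
    and \<Delta> :: "nat \<Rightarrow> nat \<Rightarrow> 'w \<Rightarrow> 'a"
    and P :: "'w measure" +
  fixes x_star :: 'a
  assumes norm_N: "is_norm N"
    and K_nonempty: "K \<noteq> {}"
    and K_convex: "convex K"
    and K_compact: "compact K"
    and R_pos: "R > 0"
    and f_convex: "convex_on UNIV f"
    and L_pos: "L > 0"
    and f_smooth: "smooth_wrt (dual_norm N) N L f"
    and x0_in: "x0 \<in> K"
    and x_star_min: "is_arg_min f (\<lambda>u. u \<in> K) x_star"
    and \<eta>_diff: "\<And>z. \<eta> differentiable (at z)"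
    and \<eta>_normalizable: "integrable lborel (\<lambda>z. exp (- \<eta> z))"
    and M_finite: "integrable (noise \<eta>) (\<lambda>z. (dual_norm N (grad \<eta> z))\<^sup>2)"
    and M_pos: "M > 0"
    and s1_pos: "s1 > 0"
    and lmo_measurable: "lmo \<in> borel_measurable borel"
    and lmo_argmax: "\<And>w. is_arg_max (\<lambda>u. u \<bullet> w) (\<lambda>u. u \<in> K) (lmo w)"
    \<comment> \<open>Not all of this follows from the above: \<open>smoothed_lower\<close> forces the noise to be centred.\<close>
    and smoothed_convex: "\<And>a. a > 0 \<Longrightarrow> convex_on UNIV (smoothed_support K \<eta> a)"
    and smoothed_smooth:
      "\<And>a. a > 0 \<Longrightarrow> smooth_wrt N (dual_norm N) (R * M / a) (smoothed_support K \<eta> a)"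
    and smoothed_grad:
      "\<And>a w. a > 0 \<Longrightarrow>
        grad (smoothed_support K \<eta> a) w = (\<integral>z. lmo (w + a *\<^sub>R z) \<partial>noise \<eta>)"
    and smoothed_lower: "\<And>a w. a > 0 \<Longrightarrow> support_fun K w \<le> smoothed_support K \<eta> a w"
    and smoothed_upper:
      "\<And>a w. a > 0 \<Longrightarrow> smoothed_support K \<eta> a w \<le> support_fun K w + a * s1"
    and \<rho>_pos: "\<rho> > 0"
    and \<epsilon>_pos: "\<epsilon> > 0"
    and m_pos: "m \<ge> 1"
    and \<Delta>_indep: "indep_vars (\<lambda>_. borel) (\<lambda>(k, i). \<Delta> k i) (UNIV \<times> {1..m})"
    and \<Delta>_law: "\<And>k i. i \<in> {1..m} \<Longrightarrow> distr P borel (\<Delta> k i) = noise \<eta>"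
    and step_regime: "R * M / \<alpha> \<ge> 1 / L"
    and variance_bound:
      "\<And>k. AE \<omega> in P.
        real_cond_exp P (past P k) (\<lambda>\<omega>. (dual_norm N (g k \<omega> - grad G (v k \<omega>)))\<^sup>2) \<omega>
          \<le> 4 * R\<^sup>2 * \<rho> / real m"

end

theory Submission
  imports Defs
begin

text \<open>
  The method is an accelerated dual averaging scheme on the dual problem of minimising
  \<open>G + f*\<close>, where the support function has been smoothed into \<open>G\<close>. Write \<open>z\<^sub>k\<close> for the gradient
  of \<open>f\<close> at \<open>x\<^sub>k\<close>, \<open>e\<^sub>k\<close> for the error of the stochastic gradient \<open>g\<^sub>k\<close> of \<open>G\<close>, and
  \<open>a\<^sub>k = A\<^sub>k\<^sub>+\<^sub>1 - A\<^sub>k\<close>. Everything rests on the potential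
  \<open>A\<^sub>k (G(y\<^sub>k) + f*(y\<^sub>k)) + (A\<^sub>k + \<beta>) f(x\<^sub>k)\<close>, which along every single run grows by at most
  \<open>a\<^sub>k (\<alpha> s\<^sub>1 + \<parallel>e\<^sub>k\<parallel>\<^sup>2 / (2 \<surd>(\<mu>\<beta>)) - \<langle>e\<^sub>k, z\<^sub>k\<rangle>)\<close> per step (\<open>potential_step\<close>). Three inequalities
  enter: the quadratic upper bound for \<open>G\<close> (\<open>G_step\<close>), the convexity of \<open>f*\<close> (\<open>f_conj_step\<close>)
  and the strong convexity of \<open>f*\<close> dual to the smoothness of \<open>f\<close> (\<open>f_step\<close>).
  The recursion for the weights is chosen so that strong convexity pays for the curvature of \<open>G\<close>
  and leaves exactly \<open>\<surd>(\<mu>\<beta>) a\<^sub>k\<close> times half the squared displacement of \<open>z\<close> to absorb the part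
  of the noise that is correlated with \<open>z\<^sub>k\<^sub>+\<^sub>1\<close>.

  As \<open>G\<close> dominates the support function and all \<open>x\<^sub>k\<close> stay in \<open>K\<close>, the potential controls the
  primal-dual gap: \<open>A\<^sub>k\<close> times the gap is at most \<open>\<beta> (f(x\<^sub>0) - f(x\<^sub>\<star>))\<close> plus the accumulated
  increments (\<open>gap_bound\<close>). In expectation the term \<open>\<langle>e\<^sub>k, z\<^sub>k\<rangle>\<close> vanishes, because \<open>z\<^sub>k\<close> depends
  on earlier perturbations only (\<open>expectation_noise_err_inner\<close>), and the variance bound takes care
  of \<open>\<parallel>e\<^sub>k\<parallel>\<^sup>2\<close>. Divided by \<open>A\<^sub>k\<close>, the three remaining contributions are at most \<open>\<epsilon>/3\<close> each:
  smoothing bias and noise by the two bounds that define \<open>\<alpha>\<close>, and the initial term because \<open>A\<^sub>k\<close>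
  grows geometrically with ratio at least \<open>1 + \<surd>(\<mu>/\<beta>)/2\<close> (\<open>weight_seq_ratio\<close>, \<open>A_large\<close>).

  The complexity bound follows by inserting the value of \<open>\<alpha>\<close>: with
  \<open>T = max (1/\<surd>\<epsilon>) (1/(\<epsilon>m))\<close>, both bounds in \<open>\<alpha>\<close> give \<open>1/\<alpha> = O(T\<^sup>2)\<close>, so the threshold is
  \<open>O(T log (1/\<epsilon>))\<close>, with one logarithmic factor.
\<close>

section \<open>Norms on a Euclidean space and their duals\<close>

lemma is_normD:
  assumes "is_norm N"
  shows "N x = 0 \<longleftrightarrow> x = 0" "N (x + y) \<le> N x + N y" "N (c *\<^sub>R x) = \<bar>c\<bar> * N x"
  using assms unfolding is_norm_def by blast+

lemma is_norm_minus: "is_norm N \<Longrightarrow> N (- x) = N x"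
  using is_normD(3)[of N "-1" x] by simp

lemma is_norm_nonneg:
  assumes "is_norm N"
  shows "N x \<ge> 0"
  using is_normD(2)[OF assms, of x "- x"] is_normD(1)[OF assms, of 0] is_norm_minus[OF assms, of x]
  by simp

lemma is_norm_pos: "is_norm N \<Longrightarrow> x \<noteq> 0 \<Longrightarrow> N x > 0"
  using is_norm_nonneg[of N x] is_normD(1)[of N x] by linarith

lemma is_norm_convex_on:
  assumes "is_norm N"
  shows "convex_on UNIV N"
proof (rule convex_onI)
  fix t :: real and x y assume "0 < t" "t < 1"
  then show "N ((1 - t) *\<^sub>R x + t *\<^sub>R y) \<le> (1 - t) * N x + t * N y"
    using is_normD(2)[OF assms, of "(1 - t) *\<^sub>R x" "t *\<^sub>R y"] by (simp add: is_normD(3)[OF assms])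
qed simp

lemma is_norm_continuous:
  fixes N :: "'a::euclidean_space \<Rightarrow> real"
  shows "is_norm N \<Longrightarrow> continuous_on UNIV N"
  by (intro convex_on_continuous is_norm_convex_on) auto

lemma is_norm_measurable:
  fixes N :: "'a::euclidean_space \<Rightarrow> real"
  shows "is_norm N \<Longrightarrow> N \<in> borel_measurable borel"
  by (intro borel_measurable_continuous_onI is_norm_continuous)

lemma is_norm_equivalent:
  fixes N :: "'a::euclidean_space \<Rightarrow> real"
  assumes N: "is_norm N"
  shows "\<exists>c>0. \<exists>C>0. \<forall>x. c * norm x \<le> N x \<and> N x \<le> C * norm x"
proof -
  let ?S = "sphere (0::'a) 1"
  have cont: "continuous_on ?S N"
    by (rule continuous_on_subset[OF is_norm_continuous[OF N]]) simp
  have ne: "?S \<noteq> {}" by simp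
  obtain p where p: "p \<in> ?S" "\<And>x. x \<in> ?S \<Longrightarrow> N p \<le> N x"
    using continuous_attains_inf[OF compact_sphere ne cont] by blast
  obtain q where q: "q \<in> ?S" "\<And>x. x \<in> ?S \<Longrightarrow> N x \<le> N q"
    using continuous_attains_sup[OF compact_sphere ne cont] by blast
  have pos: "N p > 0" "N q > 0"
    using p(1) q(1) by (auto intro!: is_norm_pos[OF N])
  have "N p * norm x \<le> N x \<and> N x \<le> N q * norm x" for x
  proof (cases "x = 0")
    case True
    then show ?thesis using is_normD(1)[OF N, of 0] by simp
  next
    case False
    then have "x /\<^sub>R norm x \<in> ?S" by simp
    from p(2)[OF this] q(2)[OF this] False show ?thesis
      by (simp add: is_normD(3)[OF N] field_simps)
  qed
  with pos show ?thesis by blast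
qed

lemma dual_norm_bdd:
  fixes N :: "'a::euclidean_space \<Rightarrow> real"
  assumes "is_norm N"
  shows "bdd_above ((\<lambda>x. z \<bullet> x) ` {x. N x \<le> 1})"
proof -
  obtain c C where c: "c > 0" "C > 0" "\<And>x. c * norm x \<le> N x" "\<And>x. N x \<le> C * norm x"
    using is_norm_equivalent[OF assms] by blast
  have "z \<bullet> x \<le> norm z * (1 / c)" if "N x \<le> 1" for x
  proof -
    have "norm x \<le> 1 / c" using c(3)[of x] that c(1) by (simp add: field_simps)
    then show ?thesis
      using norm_cauchy_schwarz[of z x] mult_left_mono[of "norm x" "1/c" "norm z"] by simp
  qed
  then show ?thesis by (intro bdd_aboveI2) auto
qed

lemma pairing_le:
  fixes N :: "'a::euclidean_space \<Rightarrow> real"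
  assumes N: "is_norm N"
  shows "z \<bullet> x \<le> dual_norm N z * N x"
proof (cases "x = 0")
  case True
  then show ?thesis using is_normD(1)[OF N, of 0] by simp
next
  case False
  then have pos: "N x > 0" using is_norm_pos[OF N] by blast
  have "z \<bullet> (x /\<^sub>R N x) \<le> dual_norm N z"
    unfolding dual_norm_def
    by (rule cSUP_upper[OF _ dual_norm_bdd[OF N]]) (use pos in \<open>simp add: is_normD(3)[OF N]\<close>)
  with pos show ?thesis by (simp add: field_simps)
qed

lemma dual_norm_le:
  fixes N :: "'a::euclidean_space \<Rightarrow> real"
  assumes "is_norm N" "\<And>x. N x \<le> 1 \<Longrightarrow> z \<bullet> x \<le> b"
  shows "dual_norm N z \<le> b"
  unfolding dual_norm_def
  using is_normD(1)[OF assms(1), of 0] assms(2) by (intro cSUP_least) (auto intro: exI[of _ 0])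

lemma is_norm_dual_norm:
  fixes N :: "'a::euclidean_space \<Rightarrow> real"
  assumes N: "is_norm N"
  shows "is_norm (dual_norm N)"
  unfolding is_norm_def
proof (intro conjI allI)
  have le: "z \<bullet> x \<le> dual_norm N z" if "N x \<le> 1" for z x
    unfolding dual_norm_def using that by (intro cSUP_upper dual_norm_bdd N) auto
  have nonneg: "dual_norm N z \<ge> 0" for z
    using le[of 0 z] is_normD(1)[OF N, of 0] by simp
  have zero: "dual_norm N 0 = 0"
    using nonneg[of 0] dual_norm_le[OF N, of 0 0] by simp
  show "dual_norm N z = 0 \<longleftrightarrow> z = 0" for z
    using zero pairing_le[OF N, of z z] by (metis inner_gt_zero_iff mult_zero_left not_le)
  show "dual_norm N (z + w) \<le> dual_norm N z + dual_norm N w" for z w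
    by (rule dual_norm_le[OF N]) (auto simp: inner_add_left intro!: add_mono le)
  have scale_le: "dual_norm N (c *\<^sub>R z) \<le> \<bar>c\<bar> * dual_norm N z" for c z
  proof (rule dual_norm_le[OF N])
    fix x assume x: "N x \<le> 1"
    have "c * (z \<bullet> x) \<le> \<bar>c\<bar> * \<bar>z \<bullet> x\<bar>" by (metis abs_ge_self abs_mult)
    also have "\<bar>z \<bullet> x\<bar> \<le> dual_norm N z"
      using le[OF x, of z] le[of "- x" z] x by (simp add: is_norm_minus[OF N] abs_le_iff)
    finally show "(c *\<^sub>R z) \<bullet> x \<le> \<bar>c\<bar> * dual_norm N z" by (simp add: mult_left_mono)
  qed
  show "dual_norm N (c *\<^sub>R z) = \<bar>c\<bar> * dual_norm N z" for c z
  proof (cases "c = 0")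
    case False
    have "\<bar>c\<bar> * dual_norm N z = \<bar>c\<bar> * dual_norm N (inverse c *\<^sub>R (c *\<^sub>R z))" using False by simp
    also have "\<dots> \<le> \<bar>c\<bar> * (\<bar>inverse c\<bar> * dual_norm N (c *\<^sub>R z))"
      by (intro mult_left_mono scale_le) simp
    also have "\<dots> = dual_norm N (c *\<^sub>R z)" using False by simp
    finally show ?thesis using scale_le[of c z] by simp
  qed (simp add: zero)
qed

text \<open>
  A hyperplane separating \<open>w / N w\<close> from the open unit ball becomes, after rescaling, a functional
  of dual norm at most one that attains \<open>N w\<close>. Hence \<open>N\<close> is in turn the dual of its dual norm,
  and smoothness of \<open>f\<close> in the dual norm can be converted into bounds on \<open>N\<close>.
\<close>

lemma norming_functional:
  fixes N :: "'a::euclidean_space \<Rightarrow> real"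
  assumes N: "is_norm N"
  obtains u where "dual_norm N u \<le> 1" "u \<bullet> w = N w"
proof (cases "w = 0")
  case True
  then show ?thesis
    using that[of 0] is_normD(1)[OF N, of 0] is_normD(1)[OF is_norm_dual_norm[OF N], of 0] by simp
next
  case False
  then have pos: "N w > 0" using is_norm_pos[OF N] by blast
  let ?S = "{x. N x < 1}" and ?p = "w /\<^sub>R N w"
  have "convex ?S"
  proof (rule convexI)
    fix x y and s t :: real
    assume xy: "x \<in> ?S" "y \<in> ?S" and st: "s \<ge> 0" "t \<ge> 0" "s + t = 1"
    have "N (s *\<^sub>R x + t *\<^sub>R y) \<le> s * N x + t * N y"
      using is_normD(2)[OF N, of "s *\<^sub>R x" "t *\<^sub>R y"] st by (simp add: is_normD(3)[OF N])
    also have "\<dots> < 1" using xy st by (intro convex_bound_lt) auto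
    finally show "s *\<^sub>R x + t *\<^sub>R y \<in> ?S" by simp
  qed
  moreover have "0 \<in> ?S" using is_normD(1)[OF N, of 0] by simp
  moreover have "?S \<inter> {?p} = {}" using pos by (simp add: is_normD(3)[OF N])
  ultimately obtain a b where a: "a \<noteq> 0" "\<And>x. N x < 1 \<Longrightarrow> a \<bullet> x \<le> b" "b \<le> a \<bullet> ?p"
    using separating_hyperplane_sets[of ?S "{?p}"] by (auto simp: inner_commute)
  have ball: "a \<bullet> x \<le> b" if "N x \<le> 1" for x
  proof (rule tendsto_upperbound[of "\<lambda>t. a \<bullet> (t *\<^sub>R x)" "a \<bullet> x" "at_left (1::real)"])
    have "((\<lambda>t. a \<bullet> (t *\<^sub>R x)) \<longlongrightarrow> a \<bullet> (1 *\<^sub>R x)) (at_left (1::real))"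
      by (intro tendsto_intros)
    then show "((\<lambda>t. a \<bullet> (t *\<^sub>R x)) \<longlongrightarrow> a \<bullet> x) (at_left (1::real))" by simp
    have "a \<bullet> (t *\<^sub>R x) \<le> b" if t: "0 < t" "t < 1" for t
    proof (rule a(2))
      have "N (t *\<^sub>R x) = t * N x" using t by (simp add: is_normD(3)[OF N])
      also have "\<dots> \<le> t * 1" using \<open>N x \<le> 1\<close> t by (intro mult_left_mono) auto
      finally show "N (t *\<^sub>R x) < 1" using t by simp
    qed
    then show "\<forall>\<^sub>F t in at_left (1::real). a \<bullet> (t *\<^sub>R x) \<le> b"
      by (intro eventually_at_leftI[of 0]) auto
  qed simp
  let ?c = "dual_norm N a"
  have c: "?c > 0" using is_norm_pos[OF is_norm_dual_norm[OF N] a(1)] .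
  have "?c \<le> a \<bullet> ?p" using dual_norm_le[OF N ball] a(3) by simp
  then have "N w \<le> (a /\<^sub>R ?c) \<bullet> w" using pos c by (simp add: field_simps)
  moreover have "dual_norm N (a /\<^sub>R ?c) = 1"
    using c by (simp add: is_normD(3)[OF is_norm_dual_norm[OF N]])
  ultimately show ?thesis
    using that[of "a /\<^sub>R ?c"] pairing_le[OF N, of "a /\<^sub>R ?c" w] by simp
qed

section \<open>Smooth and convex functions\<close>

lemma gderiv_grad:
  fixes h :: "'a::euclidean_space \<Rightarrow> real"
  assumes "h differentiable (at x)"
  shows "GDERIV h x :> grad h x"
proof -
  obtain D where D: "(h has_derivative D) (at x)" using assms by (auto simp: differentiable_def)
  interpret D: bounded_linear D using D by (rule has_derivative_bounded_linear)
  define w where "w = (\<Sum>b\<in>Basis. D b *\<^sub>R b)"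
  have "D u = u \<bullet> w" for u
  proof -
    have "D u = D (\<Sum>b\<in>Basis. (u \<bullet> b) *\<^sub>R b)" by (simp add: euclidean_representation)
    also have "\<dots> = u \<bullet> w" by (simp add: D.sum D.scaleR w_def inner_sum_right mult.commute)
    finally show ?thesis .
  qed
  then have "D = (\<lambda>u. u \<bullet> w)" by blast
  with D have ex: "GDERIV h x :> w" by (simp add: gderiv_def inner_commute)
  have "w' = w" if "GDERIV h x :> w'" for w'
  proof -
    have "(\<lambda>u. u \<bullet> w') = (\<lambda>u. u \<bullet> w)"
      using has_derivative_unique ex that by (auto simp: gderiv_def)
    then show ?thesis by (metis inner_commute vector_eq_ldot)
  qed
  with ex show ?thesis unfolding grad_def by (metis theI)
qed

lemma grad_eqI:
  fixes h :: "'a::euclidean_space \<Rightarrow> real"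
  assumes "GDERIV h x :> w"
  shows "grad h x = w"
proof -
  have "h differentiable (at x)" using assms by (auto simp: gderiv_def differentiable_def)
  from gderiv_grad[OF this] assms have "(\<lambda>u. u \<bullet> grad h x) = (\<lambda>u. u \<bullet> w)"
    unfolding gderiv_def by (rule has_derivative_unique)
  then show ?thesis by (metis inner_commute vector_eq_ldot)
qed

lemma deriv_along_line:
  fixes h :: "'a::euclidean_space \<Rightarrow> real"
  assumes "\<And>x. h differentiable (at x)"
  shows "((\<lambda>t. h (p + t *\<^sub>R u)) has_real_derivative grad h (p + t *\<^sub>R u) \<bullet> u) (at t)"
proof -
  have line: "((\<lambda>t. p + t *\<^sub>R u) has_derivative (\<lambda>s. s *\<^sub>R u)) (at t)"
    by (auto intro!: derivative_eq_intros)
  have "(h has_derivative (\<lambda>w. grad h (p + t *\<^sub>R u) \<bullet> w)) (at (p + t *\<^sub>R u))"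
    using gderiv_grad[OF assms] by (simp add: gderiv_def inner_commute)
  from has_derivative_compose[OF line this] show ?thesis
    by (simp add: has_field_derivative_def mult_commute_abs)
qed

lemma convex_above_tangent:
  fixes h :: "'a::euclidean_space \<Rightarrow> real"
  assumes convex: "convex_on UNIV h" and diff: "\<And>x. h differentiable (at x)"
  shows "h q \<ge> h p + grad h p \<bullet> (q - p)"
proof -
  let ?\<phi> = "\<lambda>t::real. h (p + t *\<^sub>R (q - p))"
  have "convex_on UNIV ?\<phi>"
  proof (rule convex_onI)
    fix t x y :: real assume t: "0 < t" "t < 1"
    have "p + ((1 - t) *\<^sub>R x + t *\<^sub>R y) *\<^sub>R (q - p)
        = (1 - t) *\<^sub>R (p + x *\<^sub>R (q - p)) + t *\<^sub>R (p + y *\<^sub>R (q - p))"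
      by (simp add: algebra_simps)
    then show "?\<phi> ((1 - t) *\<^sub>R x + t *\<^sub>R y) \<le> (1 - t) * ?\<phi> x + t * ?\<phi> y"
      using convex_onD[OF convex, of t "p + x *\<^sub>R (q - p)" "p + y *\<^sub>R (q - p)"] t by simp
  qed simp
  from convex_on_imp_above_tangent[OF this, of 0 1 "grad h p \<bullet> (q - p)"]
    deriv_along_line[OF diff, of p "q - p" 0]
  show ?thesis by simp
qed

text \<open>
  Along the segment from \<open>p\<close> to \<open>p + u\<close>, the excess of \<open>h\<close> over its quadratic model is
  nonincreasing. The pairing inequality is the only link between the two norms, so the lemma
  serves both \<open>G\<close>, with \<open>N\<close> on arguments, and \<open>f\<close>, with the dual norm on arguments.
\<close>

lemma descent:
  fixes h :: "'a::euclidean_space \<Rightarrow> real"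
  assumes N: "is_norm N" and pair: "\<And>z x. z \<bullet> x \<le> N' z * N x" and smooth: "smooth_wrt N N' C h"
  shows "h (p + u) \<le> h p + grad h p \<bullet> u + C / 2 * (N u)\<^sup>2"
proof -
  let ?\<psi> = "\<lambda>t. h (p + t *\<^sub>R u) - t * (grad h p \<bullet> u) - C / 2 * t\<^sup>2 * (N u)\<^sup>2"
  have diff: "\<And>x. h differentiable (at x)" using smooth by (simp add: smooth_wrt_def)
  have "?\<psi> 1 \<le> ?\<psi> 0"
  proof (rule DERIV_nonpos_imp_nonincreasing[of 0 1 ?\<psi>])
    fix t :: real assume t: "0 \<le> t" "t \<le> 1"
    have "(?\<psi> has_real_derivative
        (grad h (p + t *\<^sub>R u) - grad h p) \<bullet> u - C * t * (N u)\<^sup>2) (at t)"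
      by (auto intro!: derivative_eq_intros deriv_along_line[OF diff] simp: inner_diff_left)
    moreover have "(grad h (p + t *\<^sub>R u) - grad h p) \<bullet> u \<le> C * t * (N u)\<^sup>2"
    proof -
      have "(grad h (p + t *\<^sub>R u) - grad h p) \<bullet> u \<le> N' (grad h (p + t *\<^sub>R u) - grad h p) * N u"
        by (rule pair)
      also have "\<dots> \<le> (C * N (t *\<^sub>R u)) * N u"
        using smooth is_norm_nonneg[OF N, of u] unfolding smooth_wrt_def
        by (intro mult_right_mono) (metis add_diff_cancel_left', simp)
      finally show ?thesis using t by (simp add: is_normD(3)[OF N] power2_eq_square mult.assoc)
    qed
    ultimately show "\<exists>y. (?\<psi> has_real_derivative y) (at t) \<and> y \<le> 0" by fastforce
  qed simp
  then show ?thesis by simp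
qed

text \<open>
  The tangent at \<open>p\<close> lies below the quadratic upper model of \<open>f\<close> at \<open>q\<close>. The two are compared
  at the point \<open>q - t u\<close>, where \<open>u\<close> is a norming functional for the difference of the gradients and
  \<open>t\<close> the optimal step length. This is the strong convexity of \<open>f*\<close> with respect to \<open>N\<close> and with
  modulus \<open>1/L\<close>, written in terms of the points at which the gradients are taken.
\<close>

lemma cocoercive:
  fixes f :: "'a::euclidean_space \<Rightarrow> real"
  assumes N: "is_norm N" and L: "L > 0" and convex: "convex_on UNIV f"
    and smooth: "smooth_wrt (dual_norm N) N L f"
  shows "f q \<ge> f p + grad f p \<bullet> (q - p) + (N (grad f q - grad f p))\<^sup>2 / (2 * L)"
proof -
  have diff: "\<And>x. f differentiable (at x)" using smooth by (simp add: smooth_wrt_def)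
  define w where "w = grad f q - grad f p"
  obtain u where u: "dual_norm N u \<le> 1" "u \<bullet> w = N w" by (rule norming_functional[OF N])
  \<comment> \<open>the minimiser of \<open>- t N w + L t\<^sup>2 / 2\<close>\<close>
  define t where "t = N w / L"
  have t: "t \<ge> 0" unfolding t_def using is_norm_nonneg[OF N, of w] L by simp
  have N': "is_norm (dual_norm N)" using N by (rule is_norm_dual_norm)
  have pair: "z \<bullet> x \<le> N z * dual_norm N x" for z x
    using pairing_le[OF N, of x z] by (simp add: inner_commute mult.commute)
  have "f p + grad f p \<bullet> (q - t *\<^sub>R u - p) \<le> f (q + (- t) *\<^sub>R u)"
    using convex_above_tangent[OF convex diff, of p "q + (- t) *\<^sub>R u"] by (simp add: algebra_simps)
  also have "\<dots> \<le> f q + grad f q \<bullet> ((- t) *\<^sub>R u) + L / 2 * (dual_norm N ((- t) *\<^sub>R u))\<^sup>2"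
    by (rule descent[OF N' pair smooth])
  also have "(dual_norm N ((- t) *\<^sub>R u))\<^sup>2 \<le> t\<^sup>2"
    unfolding is_normD(3)[OF N']
    using u(1) t is_norm_nonneg[OF N', of u] by (intro power_mono) (auto simp: mult_left_le)
  finally have "f p + grad f p \<bullet> (q - p) + t * (u \<bullet> w) - L / 2 * t\<^sup>2 \<le> f q"
    using L by (simp add: w_def inner_diff inner_commute algebra_simps)
  moreover have "t * (u \<bullet> w) - L / 2 * t\<^sup>2 = (N w)\<^sup>2 / (2 * L)"
    using L by (simp add: u(2) t_def field_simps power2_eq_square)
  ultimately show ?thesis by (simp add: w_def)
qed

lemma smooth_wrt_continuous_grad:
  fixes h :: "'a::euclidean_space \<Rightarrow> real"
  assumes N: "is_norm N" and N': "is_norm N'" and smooth: "smooth_wrt N N' C h"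
  shows "continuous_on UNIV (grad h)"
proof -
  obtain c B where c: "c > 0" "B > 0" "\<And>x. c * norm x \<le> N' x" "\<And>x. N' x \<le> B * norm x"
    using is_norm_equivalent[OF N'] by blast
  obtain b D where D: "b > 0" "D > 0" "\<And>x. b * norm x \<le> N x" "\<And>x. N x \<le> D * norm x"
    using is_norm_equivalent[OF N] by blast
  have "norm (grad h x - grad h y) \<le> \<bar>C\<bar> * D / c * norm (x - y)" for x y
  proof -
    have "c * norm (grad h x - grad h y) \<le> N' (grad h x - grad h y)" by (rule c(3))
    also have "\<dots> \<le> C * N (x - y)" using smooth by (simp add: smooth_wrt_def)
    also have "\<dots> \<le> \<bar>C\<bar> * N (x - y)" by (intro mult_right_mono is_norm_nonneg[OF N]) simp
    also have "\<dots> \<le> \<bar>C\<bar> * (D * norm (x - y))" by (intro mult_left_mono D(4)) simp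
    finally show ?thesis using c(1) by (simp add: field_simps)
  qed
  then have "(\<bar>C\<bar> * D / c)-lipschitz_on UNIV (grad h)"
    using c(1) D(2) by (intro lipschitz_onI) (auto simp: dist_norm)
  then show ?thesis by (rule lipschitz_on_continuous_on)
qed

section \<open>Convex conjugates\<close>

lemma conjugate_ge: "ereal (u \<bullet> y - h u) \<le> conjugate h y"
  unfolding conjugate_def by (rule SUP_upper) simp

lemma conjugate_real_ge:
  assumes "\<bar>conjugate h y\<bar> \<noteq> \<infinity>"
  shows "u \<bullet> y - h u \<le> real_of_ereal (conjugate h y)"
  using conjugate_ge[of u y h] assms by (cases "conjugate h y") auto

lemma conjugate_real_leI:
  assumes "\<And>u. u \<bullet> y - h u \<le> c"
  shows "\<bar>conjugate h y\<bar> \<noteq> \<infinity>" "real_of_ereal (conjugate h y) \<le> c"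
proof -
  have le: "conjugate h y \<le> ereal c"
    unfolding conjugate_def by (rule SUP_least) (simp add: assms)
  then show fin: "\<bar>conjugate h y\<bar> \<noteq> \<infinity>"
    using conjugate_ge[of 0 y h] by (cases "conjugate h y") auto
  show "real_of_ereal (conjugate h y) \<le> c" using le fin by (cases "conjugate h y") auto
qed

text \<open>
  Convexity of the conjugate, in a form that also propagates finiteness from one iterate \<open>y\<^sub>k\<close>
  to the next.
\<close>

lemma conjugate_combination:
  assumes y: "\<bar>conjugate h y\<bar> \<noteq> \<infinity>" and t: "0 \<le> t" "t \<le> 1"
    and z: "\<And>u. u \<bullet> z - h u \<le> c"
  defines "w \<equiv> (1 - t) *\<^sub>R y + t *\<^sub>R z"
  shows "\<bar>conjugate h w\<bar> \<noteq> \<infinity>"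
    and "real_of_ereal (conjugate h w) \<le> (1 - t) * real_of_ereal (conjugate h y) + t * c"
proof -
  have "u \<bullet> w - h u \<le> (1 - t) * real_of_ereal (conjugate h y) + t * c" for u
  proof -
    have "u \<bullet> w - h u = (1 - t) * (u \<bullet> y - h u) + t * (u \<bullet> z - h u)"
      by (simp add: w_def algebra_simps)
    also have "\<dots> \<le> (1 - t) * real_of_ereal (conjugate h y) + t * c"
      using t by (intro add_mono mult_left_mono conjugate_real_ge[OF y] z) auto
    finally show ?thesis .
  qed
  from conjugate_real_leI[of w h, OF this]
  show "\<bar>conjugate h w\<bar> \<noteq> \<infinity>"
    and "real_of_ereal (conjugate h w) \<le> (1 - t) * real_of_ereal (conjugate h y) + t * c"
    by auto
qed

text \<open>
  By the tangent inequality, the supremum that defines the conjugate at \<open>grad h p\<close> is attained at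
  \<open>p\<close>.
\<close>

lemma fenchel_equality_le:
  fixes h :: "'a::euclidean_space \<Rightarrow> real"
  assumes "convex_on UNIV h" "\<And>x. h differentiable (at x)"
  shows "u \<bullet> grad h p - h u \<le> p \<bullet> grad h p - h p"
  using convex_above_tangent[OF assms, of p u] by (simp add: inner_diff_right inner_commute)

text \<open>
  The conjugate is a supremum of uncountably many functions, but these are continuous, so its
  superlevel sets are open.
\<close>

lemma conjugate_measurable [measurable]:
  fixes h :: "'a::euclidean_space \<Rightarrow> real"
  shows "conjugate h \<in> borel_measurable borel"
proof (rule borel_measurableI_greater)
  fix c
  have "{y. c < conjugate h y} = (\<Union>u. {y. c < ereal (u \<bullet> y - h u)})"
    unfolding conjugate_def by (auto simp: less_SUP_iff)
  moreover have "open {y. c < ereal (u \<bullet> y - h u)}" for u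
    by (intro open_Collect_less continuous_intros)
  ultimately have "open {y. c < conjugate h y}" by auto
  then show "{y \<in> space borel. c < conjugate h y} \<in> sets borel" by simp
qed

section \<open>The weights\<close>

(* The quadratic equation satisfied by the update is easier to use than its explicit root,
   so the recursion is kept folded. *)
declare weight_seq.simps(2) [simp del]

text \<open>
  The update is the larger root of
  \<open>(\<beta> + r) A'\<^sup>2 - (A (\<mu> + 2\<beta> + r) + \<beta>\<mu>) A' + \<beta> A\<^sup>2 = 0\<close>. In terms of the increment
  \<open>a = A' - A\<close> this is \<open>\<beta> a\<^sup>2 / A' + r a = (A + \<beta>) \<mu>\<close>: the strong convexity \<open>(A + \<beta>) \<mu>\<close>
  accumulated so far pays for the curvature \<open>\<beta> a\<^sup>2 / A'\<close> of the next step and leaves \<open>r a\<close> to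
  control the noise.
\<close>

lemma weight_seq_root:
  assumes "\<mu> > 0" "\<beta> > 0" "A \<ge> 0" "r = sqrt (\<mu> * \<beta>)"
    and "A' = (A * (\<mu> + 2 * \<beta> + r) + \<beta> * \<mu>
       + sqrt (\<mu>\<^sup>2 * (\<beta> + A)\<^sup>2 + 4 * A * \<beta>\<^sup>2 * \<mu> + 5 * A\<^sup>2 * \<mu> * \<beta> + 2 * A * \<mu> * r * (\<beta> + A)))
      / (2 * (\<beta> + r))"
  shows "A' > A" "\<beta> * (A' - A)\<^sup>2 + r * (A' - A) * A' = (A + \<beta>) * \<mu> * A'"
proof -
  define b where "b = A * (\<mu> + 2 * \<beta> + r) + \<beta> * \<mu>"
  define D where "D = \<mu>\<^sup>2 * (\<beta> + A)\<^sup>2 + 4 * A * \<beta>\<^sup>2 * \<mu> + 5 * A\<^sup>2 * \<mu> * \<beta> + 2 * A * \<mu> * r * (\<beta> + A)"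
  have r: "r > 0" "r\<^sup>2 = \<mu> * \<beta>" using assms by auto
  have pos: "\<mu>\<^sup>2 * (\<beta> + A)\<^sup>2 \<ge> 0" "4 * A * \<beta>\<^sup>2 * \<mu> \<ge> 0" "5 * A\<^sup>2 * \<mu> * \<beta> \<ge> 0" "A\<^sup>2 * \<mu> * \<beta> \<ge> 0"
    "2 * A * \<mu> * r * (\<beta> + A) \<ge> 0"
    using assms r by (auto intro!: mult_nonneg_nonneg)
  have "(r * A)\<^sup>2 = A\<^sup>2 * \<mu> * \<beta>" using r(2) by (simp add: power_mult_distrib)
  then have "(r * A)\<^sup>2 \<le> D" using pos unfolding D_def by linarith
  then have S: "sqrt D \<ge> r * A" "D \<ge> 0" by (auto intro: real_le_rsqrt) (meson order_trans zero_le_power2)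
  have A': "2 * (\<beta> + r) * A' = b + sqrt D"
    using assms r by (simp add: b_def D_def field_simps)
  have "A * \<mu> + \<beta> * \<mu> > 0" using assms by (simp add: add_nonneg_pos)
  then have "2 * (\<beta> + r) * A < b + sqrt D"
    using S(1) unfolding b_def by (simp add: algebra_simps)
  with A' have "2 * (\<beta> + r) * A < 2 * (\<beta> + r) * A'" by simp
  then show "A' > A" by (rule mult_left_less_imp_less) (use assms(2) r in simp)
  have "(2 * (\<beta> + r) * A' - b)\<^sup>2 = D" using A' S(2) by simp
  moreover have "D = b\<^sup>2 - 4 * (\<beta> + r) * \<beta> * A\<^sup>2"
  proof -
    have "r * r = \<mu> * \<beta>" "r * (r * c) = \<mu> * (\<beta> * c)" for c
      using r(2) by (simp_all add: power2_eq_square mult.assoc[symmetric])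
    then show ?thesis unfolding D_def b_def by (simp add: power2_eq_square algebra_simps)
  qed
  ultimately have "4 * (\<beta> + r) * ((\<beta> + r) * A'\<^sup>2 - b * A' + \<beta> * A\<^sup>2) = 0"
    by (simp add: power2_eq_square algebra_simps)
  then have "(\<beta> + r) * A'\<^sup>2 - b * A' + \<beta> * A\<^sup>2 = 0" using assms r by simp
  then show "\<beta> * (A' - A)\<^sup>2 + r * (A' - A) * A' = (A + \<beta>) * \<mu> * A'"
    unfolding b_def by (simp add: power2_eq_square algebra_simps)
qed

lemma weight_seq_nonneg:
  assumes "\<mu> > 0" "\<beta> > 0"
  shows "weight_seq \<mu> \<beta> k \<ge> 0"
proof (induction k)
  case (Suc k)
  show ?case using weight_seq_root(1)[OF assms Suc refl refl] Suc by (simp add: weight_seq.simps(2) Let_def)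
qed simp

lemma weight_seq_increasing:
  assumes "\<mu> > 0" "\<beta> > 0"
  shows "weight_seq \<mu> \<beta> k < weight_seq \<mu> \<beta> (Suc k)"
  using weight_seq_root(1)[OF assms weight_seq_nonneg[OF assms, of k] refl refl]
  by (simp add: weight_seq.simps(2) Let_def)

lemma weight_seq_quadratic:
  assumes "\<mu> > 0" "\<beta> > 0"
  defines "W \<equiv> weight_seq \<mu> \<beta>"
  shows "\<beta> * (W (Suc k) - W k)\<^sup>2 + sqrt (\<mu> * \<beta>) * (W (Suc k) - W k) * W (Suc k)
    = (W k + \<beta>) * \<mu> * W (Suc k)"
  using weight_seq_root(2)[OF assms(1,2) weight_seq_nonneg[OF assms(1,2), of k] refl refl]
  unfolding W_def by (simp add: weight_seq.simps(2) Let_def)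

text \<open>
  With \<open>q = \<surd>(\<mu>/\<beta>)\<close> one has \<open>\<beta> q\<^sup>2 = \<mu>\<close> and \<open>r = \<beta> q\<close>. If the increment were below \<open>q W / 2\<close>,
  the two terms on the left of the quadratic equation would be at most one quarter and one half of
  \<open>\<mu> W (W + a)\<close>, which is too small.
\<close>

lemma weight_seq_ratio:
  assumes "\<mu> > 0" "\<mu> \<le> \<beta>"
  shows "weight_seq \<mu> \<beta> (Suc k) \<ge> (1 + sqrt (\<mu> / \<beta>) / 2) * weight_seq \<mu> \<beta> k"
proof (rule ccontr)
  define W where "W = weight_seq \<mu> \<beta> k"
  define a where "a = weight_seq \<mu> \<beta> (Suc k) - W"
  define q where "q = sqrt (\<mu> / \<beta>)"
  have \<beta>: "\<beta> > 0" using assms by simp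
  have q: "q > 0" "\<beta> * q\<^sup>2 = \<mu>" "sqrt (\<mu> * \<beta>) = \<beta> * q"
    using assms \<beta> by (auto simp: q_def real_sqrt_mult real_sqrt_divide real_div_sqrt field_simps)
  have a: "a > 0" "weight_seq \<mu> \<beta> (Suc k) = W + a"
    using weight_seq_increasing[OF assms(1) \<beta>, of k] by (auto simp: a_def W_def)
  assume "\<not> weight_seq \<mu> \<beta> (Suc k) \<ge> (1 + sqrt (\<mu> / \<beta>) / 2) * weight_seq \<mu> \<beta> k"
  then have small: "2 * a < q * W" by (simp add: a_def W_def q_def algebra_simps)
  with a q have W: "W > 0" by (simp add: zero_less_mult_pos[of q W])
  have "\<beta> * a\<^sup>2 + \<beta> * q * a * (W + a) = (W + \<beta>) * \<mu> * (W + a)"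
    using weight_seq_quadratic[OF assms(1) \<beta>, of k] a by (simp add: W_def q(3))
  moreover have "(W + \<beta>) * \<mu> * (W + a) \<ge> \<mu> * W * (W + a)"
    using assms \<beta> W a by (simp add: algebra_simps)
  moreover have "\<beta> * a\<^sup>2 \<le> \<mu> * W * (W + a) / 4"
  proof -
    have "(2 * a)\<^sup>2 \<le> (q * W)\<^sup>2" using small a by (intro power_mono) auto
    then have "\<beta> * (2 * a)\<^sup>2 \<le> \<beta> * (q * W)\<^sup>2" using \<beta> by simp
    also have "\<dots> = (\<beta> * q\<^sup>2) * W * W" by (simp add: power2_eq_square)
    also have "\<dots> = \<mu> * W * W" by (simp only: q(2))
    also have "\<dots> \<le> \<mu> * W * (W + a)" using assms W a by simp
    finally show ?thesis by (simp add: power_mult_distrib)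
  qed
  moreover have "\<beta> * q * a * (W + a) \<le> \<mu> * W * (W + a) / 2"
  proof -
    have "\<beta> * q * (2 * a) * (W + a) \<le> \<beta> * q * (q * W) * (W + a)"
      using small \<beta> q W a by (intro mult_right_mono mult_left_mono) auto
    also have "\<dots> = (\<beta> * q\<^sup>2) * W * (W + a)" by (simp add: power2_eq_square)
    also have "\<dots> = \<mu> * W * (W + a)" by (simp only: q(2))
    finally show ?thesis by simp
  qed
  moreover have "\<mu> * W * (W + a) > 0" using assms W a by simp
  ultimately show False by linarith
qed

lemma weight_seq_lower_bound:
  assumes "\<mu> > 0" "\<mu> \<le> \<beta>"
  shows "weight_seq \<mu> \<beta> (Suc k) \<ge> \<mu> / 2 * exp (real k * sqrt (\<mu> / \<beta>) / 8)"
proof (induction k)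
  case 0
  have \<beta>: "\<beta> > 0" using assms by simp
  have r: "sqrt (\<mu> * \<beta>) \<le> \<beta>" "sqrt (\<mu> * \<beta>) > 0"
    using assms by (auto intro!: real_le_lsqrt simp: power2_eq_square)
  have "weight_seq \<mu> \<beta> (Suc 0) = \<beta> * \<mu> / (\<beta> + sqrt (\<mu> * \<beta>))"
  proof -
    have "weight_seq \<mu> \<beta> (Suc 0) = 2 * (\<beta> * \<mu>) / (2 * (\<beta> + sqrt (\<mu> * \<beta>)))"
      using assms \<beta> by (simp add: weight_seq.simps(2) Let_def real_sqrt_mult)
    then show ?thesis by (simp only: mult_divide_mult_cancel_left_if) simp
  qed
  also have "\<dots> \<ge> \<beta> * \<mu> / (\<beta> + \<beta>)"
    using r \<beta> assms by (intro divide_left_mono mult_pos_pos add_pos_pos mult_nonneg_nonneg) auto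
  finally show ?case using \<beta> by (simp add: field_simps)
next
  case (Suc k)
  let ?q = "sqrt (\<mu> / \<beta>)"
  have q: "0 \<le> ?q" "?q \<le> 1" using assms by (auto simp: field_simps)
  \<comment> \<open>The factor 1/8 is generous: for \<open>q \<le> 1\<close> the growth \<open>1 + q/2\<close> dominates \<open>exp (q/8)\<close>.\<close>
  have "exp (?q / 8) \<le> 1 + ?q / 8 + (?q / 8)\<^sup>2" using q by (intro exp_bound) linarith+
  also have "(?q / 8)\<^sup>2 \<le> ?q / 8 * 1"
    unfolding power2_eq_square using q by (intro mult_left_mono) linarith+
  finally have e: "exp (?q / 8) \<le> 1 + ?q / 2" using q by linarith
  have "\<mu> / 2 * exp (real (Suc k) * ?q / 8) = exp (?q / 8) * (\<mu> / 2 * exp (real k * ?q / 8))"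
    by (simp add: algebra_simps add_divide_distrib exp_add)
  also have "\<dots> \<le> (1 + ?q / 2) * weight_seq \<mu> \<beta> (Suc k)"
    using e Suc q assms by (intro mult_mono) auto
  also have "\<dots> \<le> weight_seq \<mu> \<beta> (Suc (Suc k))" by (rule weight_seq_ratio[OF assms])
  finally show ?case .
qed

section \<open>The deterministic analysis of a run\<close>

lemma (in parallel_fw_data) d_Suc:
  "fst (state (Suc k) \<omega>) = fst (state k \<omega>) + (A (Suc k) - A k) *\<^sub>R g k \<omega>"
  by (simp add: x_def y_def v_def g_def Let_def split_beta)

text \<open>
  The algorithm computes \<open>x\<^sub>k\<^sub>+\<^sub>1\<close> from the accumulated vector \<open>d\<^sub>k\<^sub>+\<^sub>1\<close>; \<open>x_step\<close> below eliminates
  that vector.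
\<close>

lemma (in parallel_fw_data) x_Suc_dual:
  "x (Suc k) \<omega> = (\<beta> / (A (Suc k) + \<beta>)) *\<^sub>R x0 - (1 / (A (Suc k) + \<beta>)) *\<^sub>R fst (state (Suc k) \<omega>)"
  by (simp add: x_def y_def v_def g_def Let_def split_beta)

lemma (in parallel_fw_data) y_Suc:
  "y (Suc k) \<omega> = (1 - \<tau> k) *\<^sub>R y k \<omega> + \<tau> k *\<^sub>R grad f (x (Suc k) \<omega>)"
  by (simp add: x_def y_def v_def g_def Let_def split_beta)

lemma (in parallel_fw_data) state_0:
  "fst (state 0 \<omega>) = 0" "x 0 \<omega> = x0" "y 0 \<omega> = grad f x0"
  by (simp_all add: x_def y_def)

context parallel_fw
begin

lemma \<alpha>_pos: "\<alpha> > 0"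
  using R_pos M_pos L_pos s1_pos \<rho>_pos \<epsilon>_pos m_pos
  unfolding \<alpha>_def smoothing_param_def by simp

lemma \<mu>_pos: "\<mu> > 0" and \<mu>_le_\<beta>: "\<mu> \<le> \<beta>" and \<beta>_pos: "\<beta> > 0"
  using L_pos step_regime \<alpha>_pos R_pos M_pos by (simp_all add: \<mu>_def \<beta>_def)

lemma A_0: "A 0 = 0"
  by (simp add: A_def)

lemma A_nonneg: "A k \<ge> 0"
  unfolding A_def by (rule weight_seq_nonneg[OF \<mu>_pos \<beta>_pos])

lemma A_less: "A k < A (Suc k)"
  unfolding A_def by (rule weight_seq_increasing[OF \<mu>_pos \<beta>_pos])

lemma A_Suc_pos: "A (Suc k) > 0"
  using A_nonneg[of k] A_less[of k] by simp

lemma dual_norm_is_norm: "is_norm (dual_norm N)"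
  using norm_N by (rule is_norm_dual_norm)

lemma f_differentiable: "f differentiable (at p)"
  using f_smooth by (simp add: smooth_wrt_def)

lemma grad_f_continuous: "continuous_on UNIV (grad f)"
  by (rule smooth_wrt_continuous_grad[OF dual_norm_is_norm norm_N f_smooth])

lemma lmo_in: "lmo w \<in> K"
  using lmo_argmax[of w] by (simp add: is_arg_max_def)

lemma lmo_max: "u \<in> K \<Longrightarrow> u \<bullet> w \<le> lmo w \<bullet> w"
  using lmo_argmax[of w] by (auto simp: is_arg_max_def not_less)

lemma support_fun_lmo: "support_fun K w = lmo w \<bullet> w"
  unfolding support_fun_def by (rule cSup_eq_maximum) (auto simp: lmo_in lmo_max)

lemma G_gderiv: "GDERIV G w :> - grad (smoothed_support K \<eta> \<alpha>) (- w)"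
proof -
  let ?s = "smoothed_support K \<eta> \<alpha>"
  have "?s differentiable (at (- w))"
    using smoothed_smooth[OF \<alpha>_pos] by (simp add: smooth_wrt_def)
  from gderiv_grad[OF this] have s: "(?s has_derivative (\<lambda>h. h \<bullet> grad ?s (- w))) (at (- w))"
    by (simp add: gderiv_def)
  have "((\<lambda>w. - w) has_derivative (\<lambda>h. - h)) (at w)"
    by (auto intro!: derivative_eq_intros)
  from has_derivative_compose[OF this s] show ?thesis
    by (simp add: gderiv_def G_def[abs_def])
qed

lemma grad_G: "grad G w = - grad (smoothed_support K \<eta> \<alpha>) (- w)"
  by (rule grad_eqI[OF G_gderiv])

lemma G_smooth: "smooth_wrt N (dual_norm N) \<beta> G"
proof -
  let ?s = "smoothed_support K \<eta> \<alpha>"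
  have "dual_norm N (grad G p - grad G q) \<le> \<beta> * N (p - q)" for p q
  proof -
    have "dual_norm N (grad ?s (- q) - grad ?s (- p)) \<le> \<beta> * N (- q - - p)"
      using smoothed_smooth[OF \<alpha>_pos] unfolding \<beta>_def smooth_wrt_def by blast
    then show ?thesis by (simp add: grad_G)
  qed
  moreover have "G differentiable (at p)" for p
    using G_gderiv by (auto simp: gderiv_def differentiable_def)
  ultimately show ?thesis by (simp add: smooth_wrt_def)
qed

lemma G_convex: "convex_on UNIV G"
proof (rule convex_onI)
  fix t :: real and p q assume "0 < t" "t < 1"
  then show "G ((1 - t) *\<^sub>R p + t *\<^sub>R q) \<le> (1 - t) * G p + t * G q"
    using convex_onD[OF smoothed_convex[OF \<alpha>_pos], of t "- p" "- q"]
    by (simp add: G_def algebra_simps)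
qed simp

lemma G_above_tangent: "G q \<ge> G p + grad G p \<bullet> (q - p)"
  using G_smooth by (intro convex_above_tangent G_convex) (simp add: smooth_wrt_def)

lemma G_0_le: "G 0 \<le> \<alpha> * s1"
  using smoothed_upper[OF \<alpha>_pos, of 0] by (simp add: G_def support_fun_lmo)

lemma support_le_G: "support_fun K (- w) \<le> G w"
  unfolding G_def by (rule smoothed_lower[OF \<alpha>_pos])

lemma minus_g_in: "- g k \<omega> \<in> K"
proof -
  have "- g k \<omega> = (\<Sum>i=1..m. (1 / real m) *\<^sub>R lmo (- v k \<omega> + \<alpha> *\<^sub>R \<Delta> k i \<omega>))"
    by (simp add: g_def oracle_mean_def sum_negf scaleR_sum_right)
  also have "\<dots> \<in> K"
    using K_convex m_pos by (intro convex_sum) (auto simp: lmo_in)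
  finally show ?thesis .
qed

lemma x_dual: "(A k + \<beta>) *\<^sub>R x k \<omega> = \<beta> *\<^sub>R x0 - fst (state k \<omega>)"
proof (cases k)
  case 0
  then show ?thesis by (simp add: state_0 A_0)
next
  case (Suc j)
  then have "A k + \<beta> \<noteq> 0" using A_Suc_pos[of j] \<beta>_pos by simp
  then show ?thesis using Suc by (simp add: x_Suc_dual scaleR_diff_right del: state.simps)
qed

text \<open>
  In the weights \<open>A\<^sub>k + \<beta>\<close>, each step is a move from \<open>x\<^sub>k\<close> towards \<open>-g\<^sub>k\<close>. Since \<open>-g\<^sub>k\<close> is an average
  of points of \<open>K\<close>, this is the Frank-Wolfe form of the update and keeps the iterates in \<open>K\<close>.
\<close>

lemma x_step: "(A (Suc k) + \<beta>) *\<^sub>R x (Suc k) \<omega> = (A k + \<beta>) *\<^sub>R x k \<omega> - (A (Suc k) - A k) *\<^sub>R g k \<omega>"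
  unfolding x_dual d_Suc by simp

lemma x_in: "x k \<omega> \<in> K"
proof (induction k)
  case 0
  then show ?case by (simp add: state_0 x0_in)
next
  case (Suc k)
  let ?S = "A (Suc k) + \<beta>"
  have S: "?S > 0" using A_Suc_pos[of k] \<beta>_pos by simp
  have "x (Suc k) \<omega> = (1 / ?S) *\<^sub>R (?S *\<^sub>R x (Suc k) \<omega>)" using S by simp
  also have "\<dots> = ((A k + \<beta>) / ?S) *\<^sub>R x k \<omega> + ((A (Suc k) - A k) / ?S) *\<^sub>R (- g k \<omega>)"
    unfolding x_step using S by (simp add: scaleR_diff_right)
  also have "\<dots> \<in> K"
    using S A_nonneg[of k] A_less[of k] \<beta>_pos
    by (intro convexD[OF K_convex Suc minus_g_in]) (auto simp: add_divide_distrib[symmetric])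
  finally show ?case .
qed

definition noise_err :: "nat \<Rightarrow> 'w \<Rightarrow> 'a" where
  "noise_err k \<omega> = g k \<omega> - grad G (v k \<omega>)"

text \<open>
  The cost of the noise in one step. The error acts on \<open>z\<^sub>k\<^sub>+\<^sub>1\<close>, which is correlated with it. This is
  split into the pairing with \<open>z\<^sub>k\<close>, which has mean zero, and the pairing with \<open>z\<^sub>k\<^sub>+\<^sub>1 - z\<^sub>k\<close>, which
  the reserve in the weights reduces to the squared norm.
\<close>

definition step_err :: "nat \<Rightarrow> 'w \<Rightarrow> real" where
  "step_err k \<omega> = (dual_norm N (noise_err k \<omega>))\<^sup>2 / (2 * sqrt (\<mu> * \<beta>))
     - noise_err k \<omega> \<bullet> grad f (x k \<omega>)"

definition f_conj :: "nat \<Rightarrow> 'w \<Rightarrow> real" where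
  "f_conj k \<omega> = real_of_ereal (conjugate f (y k \<omega>))"

text \<open>
  The function \<open>f\<close> enters through the value of the regularised dual model: the minimum over \<open>z\<close> of
  \<open>\<langle>d\<^sub>k, z\<rangle> + A\<^sub>k f*(z) + \<beta> (f*(z) - \<langle>x\<^sub>0, z\<rangle>)\<close> is \<open>- (A\<^sub>k + \<beta>) f(x\<^sub>k)\<close>, attained at the gradient
  of \<open>f\<close> at \<open>x\<^sub>k\<close>.
\<close>

definition potential :: "nat \<Rightarrow> 'w \<Rightarrow> real" where
  "potential k \<omega> = A k * (G (y k \<omega>) + f_conj k \<omega>) + (A k + \<beta>) * f (x k \<omega>)"

lemma \<tau>_bounds: "0 \<le> \<tau> k" "\<tau> k \<le> 1"
  using A_nonneg[of k] A_less[of k] A_Suc_pos[of k] by (simp_all add: \<tau>_def)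

lemma conjugate_y_finite: "\<bar>conjugate f (y k \<omega>)\<bar> \<noteq> \<infinity>"
proof (induction k)
  case 0
  show ?case
    unfolding state_0
    by (rule conjugate_real_leI(1), rule fenchel_equality_le[OF f_convex f_differentiable])
next
  case (Suc k)
  show ?case
    unfolding y_Suc
    by (rule conjugate_combination(1)[OF Suc \<tau>_bounds fenchel_equality_le[OF f_convex f_differentiable]])
qed

lemma f_conj_step:
  "A (Suc k) * f_conj (Suc k) \<omega>
    \<le> A k * f_conj k \<omega> + (A (Suc k) - A k) * (x (Suc k) \<omega> \<bullet> grad f (x (Suc k) \<omega>) - f (x (Suc k) \<omega>))"
proof -
  let ?p = "x (Suc k) \<omega>"
  have "f_conj (Suc k) \<omega> \<le> (1 - \<tau> k) * f_conj k \<omega> + \<tau> k * (?p \<bullet> grad f ?p - f ?p)"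
    unfolding f_conj_def y_Suc
    by (intro conjugate_combination(2) conjugate_y_finite \<tau>_bounds fenchel_equality_le
        f_convex f_differentiable)
  then have "A (Suc k) * f_conj (Suc k) \<omega>
      \<le> A (Suc k) * ((1 - \<tau> k) * f_conj k \<omega> + \<tau> k * (?p \<bullet> grad f ?p - f ?p))"
    using A_Suc_pos[of k] by simp
  also have "\<dots> = (A (Suc k) * (1 - \<tau> k)) * f_conj k \<omega>
      + (A (Suc k) * \<tau> k) * (?p \<bullet> grad f ?p - f ?p)"
    by (simp add: algebra_simps)
  also have "A (Suc k) * (1 - \<tau> k) = A k" using A_Suc_pos[of k] by (simp add: \<tau>_def)
  also have "A (Suc k) * \<tau> k = A (Suc k) - A k"
    using A_Suc_pos[of k] by (simp add: \<tau>_def field_simps)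
  finally show ?thesis .
qed

text \<open>
  The linearisation of \<open>G\<close> at \<open>v\<^sub>k\<close> is evaluated at \<open>y\<^sub>k\<^sub>+\<^sub>1\<close>, a convex combination of \<open>y\<^sub>k\<close> and
  \<open>z\<^sub>k\<^sub>+\<^sub>1\<close>. The first contributes at most \<open>G(y\<^sub>k)\<close>; for the second, the intercept of the tangent at
  the origin is at most \<open>G(0)\<close>, which is the smoothing bias. Since \<open>v\<^sub>k\<close> combines \<open>y\<^sub>k\<close> and \<open>z\<^sub>k\<close> with
  the same weights, \<open>y\<^sub>k\<^sub>+\<^sub>1 - v\<^sub>k\<close> is \<open>\<tau>\<^sub>k\<close> times \<open>z\<^sub>k\<^sub>+\<^sub>1 - z\<^sub>k\<close>.
\<close>

lemma G_step:
  defines "a \<equiv> \<lambda>k. A (Suc k) - A k" and "z \<equiv> \<lambda>k \<omega>. grad f (x k \<omega>)"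
  shows "A (Suc k) * G (y (Suc k) \<omega>) \<le> A k * G (y k \<omega>)
    + a k * (\<alpha> * s1 + grad G (v k \<omega>) \<bullet> z (Suc k) \<omega>)
    + \<beta> * (a k)\<^sup>2 / (2 * A (Suc k)) * (N (z (Suc k) \<omega> - z k \<omega>))\<^sup>2"
proof -
  let ?V = "v k \<omega>" and ?Y = "y k \<omega>" and ?Y' = "y (Suc k) \<omega>" and ?A' = "A (Suc k)"
  let ?z = "z k \<omega>" and ?z' = "z (Suc k) \<omega>" and ?D = "grad G (v k \<omega>)"
  have A': "?A' > 0" by (rule A_Suc_pos)
  have \<tau>: "?A' * \<tau> k = a k" using A' by (simp add: \<tau>_def a_def field_simps)
  have diff: "?Y' - ?V = \<tau> k *\<^sub>R (?z' - ?z)"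
    by (simp add: y_Suc v_def extrapolate_def z_def algebra_simps)
  have "?A' *\<^sub>R ?Y' = (?A' * (1 - \<tau> k)) *\<^sub>R ?Y + (?A' * \<tau> k) *\<^sub>R ?z'"
    by (simp add: y_Suc z_def scaleR_add_right)
  also have "?A' * (1 - \<tau> k) = A k" using A' by (simp add: \<tau>_def)
  finally have comb: "?A' *\<^sub>R ?Y' = A k *\<^sub>R ?Y + a k *\<^sub>R ?z'" unfolding \<tau> .
  have "?A' *\<^sub>R (?Y' - ?V) = A k *\<^sub>R (?Y - ?V) + a k *\<^sub>R (?z' - ?V)"
    unfolding scaleR_diff_right comb by (simp add: a_def algebra_simps)
  then have lin: "?A' * (?D \<bullet> (?Y' - ?V)) = A k * (?D \<bullet> (?Y - ?V)) + a k * (?D \<bullet> (?z' - ?V))"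
    by (metis inner_add_right inner_scaleR_right)
  have "G (?V + (?Y' - ?V)) \<le> G ?V + ?D \<bullet> (?Y' - ?V) + \<beta> / 2 * (N (?Y' - ?V))\<^sup>2"
    by (rule descent[OF norm_N pairing_le[OF norm_N] G_smooth])
  also have "(N (?Y' - ?V))\<^sup>2 = (\<tau> k)\<^sup>2 * (N (?z' - ?z))\<^sup>2"
    by (simp add: diff is_normD(3)[OF norm_N] power_mult_distrib)
  finally have "?A' * G ?Y' \<le> ?A' * (G ?V + ?D \<bullet> (?Y' - ?V) + \<beta> / 2 * ((\<tau> k)\<^sup>2 * (N (?z' - ?z))\<^sup>2))"
    using A' by simp
  also have "\<dots> = ?A' * G ?V + ?A' * (?D \<bullet> (?Y' - ?V)) + \<beta> * (?A' * (\<tau> k)\<^sup>2) / 2 * (N (?z' - ?z))\<^sup>2"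
    by (simp add: algebra_simps)
  also have "?A' * (\<tau> k)\<^sup>2 = (a k)\<^sup>2 / ?A'"
    using A' by (simp add: \<tau>[symmetric] power_mult_distrib power2_eq_square)
  also have "?A' * G ?V + ?A' * (?D \<bullet> (?Y' - ?V))
      = A k * (G ?V + ?D \<bullet> (?Y - ?V)) + a k * (G ?V + ?D \<bullet> (0 - ?V)) + a k * (?D \<bullet> ?z')"
    unfolding lin by (simp add: a_def inner_diff_right algebra_simps)
  also have "\<dots> \<le> A k * G ?Y + a k * (\<alpha> * s1) + a k * (?D \<bullet> ?z')"
    using A_nonneg[of k] A_less[of k] order_trans[OF G_above_tangent[of ?V 0] G_0_le]
    by (intro add_mono mult_left_mono G_above_tangent) (auto simp: a_def)
  finally show ?thesis by (simp add: algebra_simps)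
qed

text \<open>
  The strong convexity of \<open>f*\<close>, weighted by \<open>A\<^sub>k + \<beta>\<close>; \<open>x_step\<close> rewrites the displacement of \<open>x\<close>
  through \<open>g\<^sub>k\<close>.
\<close>

lemma f_step:
  defines "a \<equiv> \<lambda>k. A (Suc k) - A k" and "z \<equiv> \<lambda>k \<omega>. grad f (x k \<omega>)"
  shows "(A k + \<beta>) * f (x (Suc k) \<omega>) \<le> (A k + \<beta>) * f (x k \<omega>)
    - a k * (g k \<omega> \<bullet> z (Suc k) \<omega>) - a k * (x (Suc k) \<omega> \<bullet> z (Suc k) \<omega>)
    - (A k + \<beta>) * \<mu> / 2 * (N (z (Suc k) \<omega> - z k \<omega>))\<^sup>2"
proof -
  let ?p = "x k \<omega>" and ?q = "x (Suc k) \<omega>" and ?n = "(N (z (Suc k) \<omega> - z k \<omega>))\<^sup>2"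
  have "N (z k \<omega> - z (Suc k) \<omega>) = N (z (Suc k) \<omega> - z k \<omega>)"
    using is_norm_minus[OF norm_N, of "z k \<omega> - z (Suc k) \<omega>"] by simp
  then have "f ?q + z (Suc k) \<omega> \<bullet> (?p - ?q) + \<mu> / 2 * ?n \<le> f ?p"
    using cocoercive[OF norm_N L_pos f_convex f_smooth, of ?q ?p] by (simp add: z_def \<mu>_def)
  then have "(A k + \<beta>) * (f ?q + z (Suc k) \<omega> \<bullet> (?p - ?q) + \<mu> / 2 * ?n) \<le> (A k + \<beta>) * f ?p"
    using A_nonneg[of k] \<beta>_pos by (intro mult_left_mono) auto
  moreover have "(A k + \<beta>) *\<^sub>R (?p - ?q) = a k *\<^sub>R g k \<omega> + a k *\<^sub>R ?q"
    using x_step[of k \<omega>] by (simp add: a_def algebra_simps)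
  then have "z (Suc k) \<omega> \<bullet> ((A k + \<beta>) *\<^sub>R (?p - ?q))
      = z (Suc k) \<omega> \<bullet> (a k *\<^sub>R g k \<omega> + a k *\<^sub>R ?q)" by (rule arg_cong)
  then have "(A k + \<beta>) * (z (Suc k) \<omega> \<bullet> (?p - ?q))
      = a k * (g k \<omega> \<bullet> z (Suc k) \<omega>) + a k * (?q \<bullet> z (Suc k) \<omega>)"
    by (simp only: inner_scaleR_right inner_add_right inner_commute)
  ultimately show ?thesis
    unfolding distrib_left[of "A k + \<beta>"] by (simp only: times_divide_eq_right mult.assoc times_divide_eq_left)
qed

text \<open>
  In the sum of the bounds on \<open>G\<close>, \<open>f*\<close> and \<open>f\<close>, the terms in \<open>x\<^sub>k\<^sub>+\<^sub>1\<close> cancel, the true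
  gradient and \<open>g\<^sub>k\<close> combine into the noise paired with \<open>z\<^sub>k\<^sub>+\<^sub>1\<close>, and by the choice of the weights
  the quadratic terms leave \<open>- a \<surd>(\<mu>\<beta>) / 2\<close> times the squared displacement of \<open>z\<close>. Young's
  inequality absorbs the correlated part of the noise in it.
\<close>

lemma potential_step:
  "potential (Suc k) \<omega> \<le> potential k \<omega> + (A (Suc k) - A k) * (\<alpha> * s1 + step_err k \<omega>)"
proof -
  define a where "a = A (Suc k) - A k"
  define z where "z = grad f (x k \<omega>)"
  define z' where "z' = grad f (x (Suc k) \<omega>)"
  define n where "n = N (z' - z)"
  define e where "e = noise_err k \<omega>"
  define r where "r = sqrt (\<mu> * \<beta>)"
  have a: "a > 0" using A_less[of k] by (simp add: a_def)
  have r: "r > 0" using \<mu>_pos \<beta>_pos by (simp add: r_def)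
  have A': "A (Suc k) > 0" by (rule A_Suc_pos)
  have "\<beta> * a\<^sup>2 + r * a * A (Suc k) = (A k + \<beta>) * \<mu> * A (Suc k)"
    using weight_seq_quadratic[OF \<mu>_pos \<beta>_pos, of k] by (simp add: a_def r_def A_def)
  then have "\<beta> * a\<^sup>2 / A (Suc k) + r * a = (A k + \<beta>) * \<mu>"
    using A' by (simp add: field_simps)
  then have "(\<beta> * a\<^sup>2 / A (Suc k) + r * a) * n\<^sup>2 / 2 = (A k + \<beta>) * \<mu> * n\<^sup>2 / 2" by simp
  then have curv: "\<beta> * a\<^sup>2 / (2 * A (Suc k)) * n\<^sup>2 = (A k + \<beta>) * \<mu> / 2 * n\<^sup>2 - a * (r / 2 * n\<^sup>2)"
    by (simp add: algebra_simps)
  have "- e \<bullet> (z' - z) \<le> dual_norm N (- e) * n"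
    unfolding n_def by (rule pairing_le[OF norm_N])
  also have "\<dots> = dual_norm N e * n" by (simp add: is_norm_minus[OF dual_norm_is_norm])
  also have "\<dots> \<le> (dual_norm N e)\<^sup>2 / (2 * r) + r / 2 * n\<^sup>2"
  proof -
    have "0 \<le> (dual_norm N e - r * n)\<^sup>2 / (2 * r)" using r by simp
    also have "\<dots> = (dual_norm N e)\<^sup>2 / (2 * r) + r / 2 * n\<^sup>2 - dual_norm N e * n"
      using r by (simp add: power2_eq_square field_simps)
    finally show ?thesis by simp
  qed
  finally have "- (e \<bullet> z') - r / 2 * n\<^sup>2 \<le> step_err k \<omega>"
    by (simp add: step_err_def e_def z_def r_def inner_diff_right)
  then have "a * (- (e \<bullet> z') - r / 2 * n\<^sup>2) \<le> a * step_err k \<omega>"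
    using a by (intro mult_left_mono) auto
  moreover have "a * (e \<bullet> z') = a * (g k \<omega> \<bullet> z') - a * (grad G (v k \<omega>) \<bullet> z')"
    by (simp add: e_def noise_err_def inner_diff_left algebra_simps)
  moreover have "A (Suc k) * G (y (Suc k) \<omega>) \<le> A k * G (y k \<omega>)
      + a * (\<alpha> * s1 + grad G (v k \<omega>) \<bullet> z') + \<beta> * a\<^sup>2 / (2 * A (Suc k)) * n\<^sup>2"
    using G_step[of k \<omega>] by (simp add: a_def z_def z'_def n_def)
  moreover have "(A k + \<beta>) * f (x (Suc k) \<omega>) \<le> (A k + \<beta>) * f (x k \<omega>)
      - a * (g k \<omega> \<bullet> z') - a * (x (Suc k) \<omega> \<bullet> z') - (A k + \<beta>) * \<mu> / 2 * n\<^sup>2"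
    using f_step[of k \<omega>] by (simp add: a_def z_def z'_def n_def)
  moreover have "A (Suc k) * f_conj (Suc k) \<omega>
      \<le> A k * f_conj k \<omega> + a * (x (Suc k) \<omega> \<bullet> z') - a * f (x (Suc k) \<omega>)"
    using f_conj_step[of k \<omega>] by (simp add: a_def z'_def right_diff_distrib)
  moreover have "(A (Suc k) + \<beta>) * f (x (Suc k) \<omega>)
      = (A k + \<beta>) * f (x (Suc k) \<omega>) + a * f (x (Suc k) \<omega>)"
    by (simp add: a_def algebra_simps)
  ultimately show ?thesis
    using curv unfolding potential_def a_def[symmetric] distrib_left right_diff_distrib
    by linarith
qed

lemma potential_bound:
  "potential k \<omega> \<le> \<beta> * f x0 + A k * (\<alpha> * s1) + (\<Sum>i<k. (A (Suc i) - A i) * step_err i \<omega>)"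
proof (induction k)
  case 0
  then show ?case by (simp add: potential_def A_0 state_0)
next
  case (Suc k)
  have "A (Suc k) * (\<alpha> * s1) = A k * (\<alpha> * s1) + (A (Suc k) - A k) * (\<alpha> * s1)"
    by (simp add: left_diff_distrib)
  then show ?case
    using potential_step[of k \<omega>] Suc unfolding sum.lessThan_Suc distrib_left by linarith
qed

definition gap :: "nat \<Rightarrow> 'w \<Rightarrow> real" where
  "gap k \<omega> = f (x k \<omega>) - real_of_ereal (dual_obj K f (y k \<omega>))"

lemma dual_obj_y:
  "dual_obj K f (y k \<omega>) = ereal (- support_fun K (- y k \<omega>) - f_conj k \<omega>)"
  using conjugate_y_finite[of k \<omega>]
  by (cases "conjugate f (y k \<omega>)") (auto simp: dual_obj_def f_conj_def)

lemma gap_eq: "gap k \<omega> = f (x k \<omega>) + support_fun K (- y k \<omega>) + f_conj k \<omega>"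
  unfolding gap_def dual_obj_y by simp

text \<open>
  Weak duality. Together with \<open>gap_bound\<close> it makes the gap integrable.
\<close>

lemma gap_nonneg: "gap k \<omega> \<ge> 0"
proof -
  have "x k \<omega> \<bullet> y k \<omega> - f (x k \<omega>) \<le> f_conj k \<omega>"
    unfolding f_conj_def by (rule conjugate_real_ge[OF conjugate_y_finite])
  then show ?thesis
    using lmo_max[OF x_in, of k \<omega> "- y k \<omega>"] by (simp add: gap_eq support_fun_lmo)
qed

lemma f_x_star_le: "u \<in> K \<Longrightarrow> f x_star \<le> f u"
  using x_star_min by (auto simp: is_arg_min_def not_less)

text \<open>
  Replacing \<open>G\<close> by the smaller support function and \<open>f(x\<^sub>k)\<close>, in the part weighted by \<open>\<beta>\<close>, by the
  minimum of \<open>f\<close> over \<open>K\<close> bounds the potential from below by \<open>A\<^sub>k\<close> times the gap plus \<open>\<beta> f(x\<^sub>\<star>)\<close>.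
\<close>

lemma gap_bound:
  "A k * gap k \<omega> \<le> \<beta> * (f x0 - f x_star) + A k * (\<alpha> * s1)
    + (\<Sum>i<k. (A (Suc i) - A i) * step_err i \<omega>)"
proof -
  have "A k * support_fun K (- y k \<omega>) \<le> A k * G (y k \<omega>)"
    by (intro mult_left_mono support_le_G A_nonneg)
  moreover have "\<beta> * f x_star \<le> \<beta> * f (x k \<omega>)"
    using \<beta>_pos by (intro mult_left_mono f_x_star_le x_in) simp
  ultimately show ?thesis
    using potential_bound[of k \<omega>]
    unfolding potential_def gap_eq distrib_left distrib_right right_diff_distrib by linarith
qed

end

section \<open>Expectations\<close>

text \<open>
  Independence of two variables turns into a product law for functions of them, which may take
  values in different types.
\<close>

lemma (in prob_space) indep_var_compose_law:
  assumes indep: "indep_var S X T Y"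
    and F[measurable]: "F \<in> S \<rightarrow>\<^sub>M S'" and H[measurable]: "H \<in> T \<rightarrow>\<^sub>M T'"
  shows "distr M S' (\<lambda>\<omega>. F (X \<omega>)) \<Otimes>\<^sub>M distr M T' (\<lambda>\<omega>. H (Y \<omega>))
    = distr M (S' \<Otimes>\<^sub>M T') (\<lambda>\<omega>. (F (X \<omega>), H (Y \<omega>)))"
proof -
  have [measurable]: "X \<in> M \<rightarrow>\<^sub>M S" "Y \<in> M \<rightarrow>\<^sub>M T"
    and eq: "distr M S X \<Otimes>\<^sub>M distr M T Y = distr M (S \<Otimes>\<^sub>M T) (\<lambda>\<omega>. (X \<omega>, Y \<omega>))"
    using indep by (auto simp: indep_var_distribution_eq)
  have "prob_space (distr M T' (\<lambda>\<omega>. H (Y \<omega>)))" by (rule prob_space_distr) measurable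
  then have sigma: "sigma_finite_measure (distr (distr M T Y) T' H)"
    by (simp add: distr_distr comp_def prob_space_imp_sigma_finite)
  have "distr M S' (\<lambda>\<omega>. F (X \<omega>)) \<Otimes>\<^sub>M distr M T' (\<lambda>\<omega>. H (Y \<omega>))
      = distr (distr M S X) S' F \<Otimes>\<^sub>M distr (distr M T Y) T' H"
    by (simp add: distr_distr comp_def)
  also have "\<dots> = distr (distr M S X \<Otimes>\<^sub>M distr M T Y) (S' \<Otimes>\<^sub>M T') (\<lambda>(p, q). (F p, H q))"
    by (rule pair_measure_distr) (use sigma in simp_all)
  also have "\<dots> = distr M (S' \<Otimes>\<^sub>M T') (\<lambda>\<omega>. (F (X \<omega>), H (Y \<omega>)))"
    unfolding eq by (subst distr_distr) (simp_all add: comp_def)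
  finally show ?thesis .
qed

text \<open>
  If \<open>X\<close> and \<open>Y\<close> are independent, then \<open>Y\<close> may be averaged out with \<open>X\<close> held fixed: Fubini's theorem
  for the product law.
\<close>

lemma (in prob_space) expectation_freeze:
  fixes h :: "'b \<times> 'c \<Rightarrow> real"
  assumes X[measurable]: "X \<in> M \<rightarrow>\<^sub>M S" and Y[measurable]: "Y \<in> M \<rightarrow>\<^sub>M T"
    and eq: "distr M S X \<Otimes>\<^sub>M distr M T Y = distr M (S \<Otimes>\<^sub>M T) (\<lambda>\<omega>. (X \<omega>, Y \<omega>))"
    and h[measurable]: "h \<in> borel_measurable (S \<Otimes>\<^sub>M T)"
    and int: "integrable M (\<lambda>\<omega>. h (X \<omega>, Y \<omega>))"
  shows "expectation (\<lambda>\<omega>. h (X \<omega>, Y \<omega>)) = expectation (\<lambda>\<omega>. \<integral>\<zeta>. h (X \<omega>, \<zeta>) \<partial>distr M T Y)"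
proof -
  interpret X: prob_space "distr M S X" by (rule prob_space_distr) simp
  interpret Y: prob_space "distr M T Y" by (rule prob_space_distr) simp
  interpret pair_sigma_finite "distr M S X" "distr M T Y" ..
  have "integrable (distr M S X \<Otimes>\<^sub>M distr M T Y) h"
    unfolding eq using int by (simp add: integrable_distr_eq)
  then have fubini: "(\<integral>p. \<integral>\<zeta>. h (p, \<zeta>) \<partial>distr M T Y \<partial>distr M S X)
      = integral\<^sup>L (distr M S X \<Otimes>\<^sub>M distr M T Y) h"
    by (rule integral_fst')
  have "expectation (\<lambda>\<omega>. h (X \<omega>, Y \<omega>)) = integral\<^sup>L (distr M (S \<Otimes>\<^sub>M T) (\<lambda>\<omega>. (X \<omega>, Y \<omega>))) h"
    by (simp add: integral_distr)
  also have "\<dots> = (\<integral>p. \<integral>\<zeta>. h (p, \<zeta>) \<partial>distr M T Y \<partial>distr M S X)"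
    by (simp add: fubini eq)
  also have "\<dots> = expectation (\<lambda>\<omega>. \<integral>\<zeta>. h (X \<omega>, \<zeta>) \<partial>distr M T Y)"
    by (rule integral_distr) (simp_all add: borel_measurable_integrable)
  finally show ?thesis .
qed

text \<open>
  The state after \<open>k\<close> rounds depends on the perturbations of earlier rounds only. The second family
  of perturbations may live on another sample space; taking the coordinate projections exhibits the
  state as a function of the tuple of past perturbations.
\<close>

lemma (in parallel_fw_data) state_cong:
  assumes "\<And>j i. j < k \<Longrightarrow> i \<in> {1..m} \<Longrightarrow> \<Delta> j i \<omega> = \<Delta>' j i \<omega>'"
  shows "state k \<omega> = parallel_fw_data.state N K f L x0 \<eta> lmo \<rho> m \<epsilon> \<Delta>' k \<omega>'"
proof -
  interpret o: parallel_fw_data N K f L x0 \<eta> lmo \<rho> m \<epsilon> \<Delta>' .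
  have "state k \<omega> = o.state k \<omega>'" using assms
  proof (induction k)
    case 0
    show ?case by simp
  next
    case (Suc k)
    have "oracle_mean k w \<omega> = o.oracle_mean k w \<omega>'" for w
      unfolding oracle_mean_def o.oracle_mean_def using Suc.prems by simp
    with Suc show ?case by simp
  qed
  then show ?thesis .
qed

lemma (in parallel_fw_data) oracle_mean_measurable:
  assumes lmo[measurable]: "lmo \<in> borel_measurable borel"
    and w[measurable]: "w \<in> borel_measurable Q"
    and \<Delta>: "\<And>i. i \<in> {1..m} \<Longrightarrow> \<Delta> k i \<in> borel_measurable Q"
  shows "(\<lambda>\<omega>. oracle_mean k (w \<omega>) \<omega>) \<in> borel_measurable Q"
proof -
  have "(\<lambda>\<omega>. - lmo (- w \<omega> + \<alpha> *\<^sub>R \<Delta> k i \<omega>)) \<in> borel_measurable Q" if "i \<in> {1..m}" for i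
    using \<Delta>[OF that] by measurable
  then have "(\<lambda>\<omega>. \<Sum>i=1..m. - lmo (- w \<omega> + \<alpha> *\<^sub>R \<Delta> k i \<omega>)) \<in> borel_measurable Q"
    by (rule borel_measurable_sum)
  then show ?thesis unfolding oracle_mean_def by measurable
qed

lemma (in parallel_fw_data) state_measurable:
  assumes lmo: "lmo \<in> borel_measurable borel"
    and f[measurable]: "grad f \<in> borel_measurable borel"
    and \<Delta>: "\<And>j i. j < k \<Longrightarrow> i \<in> {1..m} \<Longrightarrow> \<Delta> j i \<in> borel_measurable Q"
  shows "state k \<in> Q \<rightarrow>\<^sub>M borel \<Otimes>\<^sub>M borel \<Otimes>\<^sub>M borel"
  using \<Delta>
proof (induction k)
  case 0
  show ?case by simp
next
  case (Suc k)
  then have [measurable]: "state k \<in> Q \<rightarrow>\<^sub>M borel \<Otimes>\<^sub>M borel \<Otimes>\<^sub>M borel" by simp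
  have [measurable]: "v k \<in> borel_measurable Q"
    unfolding v_def[abs_def] x_def y_def extrapolate_def by measurable
  have [measurable]: "g k \<in> borel_measurable Q"
    unfolding g_def[abs_def] using Suc.prems by (intro oracle_mean_measurable lmo) auto
  have [measurable]: "(\<lambda>\<omega>. fst (state (Suc k) \<omega>)) \<in> borel_measurable Q"
    unfolding d_Suc by measurable
  have [measurable]: "x (Suc k) \<in> borel_measurable Q"
    unfolding x_Suc_dual[abs_def] by measurable
  have [measurable]: "y k \<in> borel_measurable Q"
    unfolding y_def[abs_def] by measurable
  have [measurable]: "y (Suc k) \<in> borel_measurable Q"
    unfolding y_Suc[abs_def] by measurable
  have "state (Suc k) = (\<lambda>\<omega>. (fst (state (Suc k) \<omega>), x (Suc k) \<omega>, y (Suc k) \<omega>))"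
    unfolding x_def y_def by simp
  also have "\<dots> \<in> Q \<rightarrow>\<^sub>M borel \<Otimes>\<^sub>M borel \<Otimes>\<^sub>M borel" by measurable
  finally show ?case .
qed

context parallel_fw
begin

lemma \<Delta>_measurable: "i \<in> {1..m} \<Longrightarrow> \<Delta> k i \<in> borel_measurable P"
  using \<Delta>_indep unfolding indep_vars_def by auto

lemma grad_f_measurable [measurable]: "grad f \<in> borel_measurable borel"
  by (intro borel_measurable_continuous_onI grad_f_continuous)

lemma grad_G_measurable [measurable]: "grad G \<in> borel_measurable borel"
  by (intro borel_measurable_continuous_onI
      smooth_wrt_continuous_grad[OF norm_N dual_norm_is_norm G_smooth])

lemma f_measurable [measurable]: "f \<in> borel_measurable borel"
  using f_differentiable differentiable_imp_continuous_within
  by (intro borel_measurable_continuous_onI continuous_at_imp_continuous_on) blast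

lemmas lmo_measurable [measurable]

lemma dual_norm_measurable [measurable]: "dual_norm N \<in> borel_measurable borel"
  by (rule is_norm_measurable[OF dual_norm_is_norm])

lemma iterate_measurable [measurable]:
  "x k \<in> borel_measurable P" "y k \<in> borel_measurable P" "v k \<in> borel_measurable P"
  "g k \<in> borel_measurable P"
proof -
  have [measurable]: "state k \<in> P \<rightarrow>\<^sub>M borel \<Otimes>\<^sub>M borel \<Otimes>\<^sub>M borel"
    by (intro state_measurable lmo_measurable grad_f_measurable \<Delta>_measurable)
  show [measurable]: "x k \<in> borel_measurable P" "y k \<in> borel_measurable P"
    unfolding x_def[abs_def] y_def[abs_def] by measurable
  show [measurable]: "v k \<in> borel_measurable P"
    unfolding v_def[abs_def] extrapolate_def by measurable
  show "g k \<in> borel_measurable P"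
    unfolding g_def[abs_def] by (intro oracle_mean_measurable lmo_measurable \<Delta>_measurable) measurable
qed

lemma noise_err_measurable [measurable]: "noise_err k \<in> borel_measurable P"
  unfolding noise_err_def[abs_def] by measurable

text \<open>
  The point at which the oracle is queried and the vector \<open>z\<^sub>k\<close> are functions of the past
  perturbations, so they are independent of the fresh ones.
\<close>

lemma indep_past:
  assumes i: "i \<in> {1..m}"
  shows "distr P (borel \<Otimes>\<^sub>M borel) (\<lambda>\<omega>. (v k \<omega>, grad f (x k \<omega>))) \<Otimes>\<^sub>M distr P borel (\<Delta> k i)
    = distr P ((borel \<Otimes>\<^sub>M borel) \<Otimes>\<^sub>M borel) (\<lambda>\<omega>. ((v k \<omega>, grad f (x k \<omega>)), \<Delta> k i \<omega>))"
proof -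
  let ?I = "{..<k} \<times> {1..m}" and ?X = "\<lambda>(k, i). \<Delta> k i"
  let ?\<Delta>' = "\<lambda>j i \<phi>. \<phi> (j, i)"
  interpret o: parallel_fw_data N K f L x0 \<eta> lmo \<rho> m \<epsilon> ?\<Delta>' .
  let ?Q = "PiM ?I (\<lambda>_. borel :: 'a measure)"
  have [measurable]: "o.state k \<in> ?Q \<rightarrow>\<^sub>M borel \<Otimes>\<^sub>M borel \<Otimes>\<^sub>M borel"
    by (intro o.state_measurable lmo_measurable grad_f_measurable measurable_component_singleton) auto
  have F: "(\<lambda>\<phi>. (o.v k \<phi>, grad f (o.x k \<phi>))) \<in> ?Q \<rightarrow>\<^sub>M borel \<Otimes>\<^sub>M borel"
    unfolding o.v_def o.x_def o.y_def extrapolate_def by measurable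
  have state: "state k \<omega> = o.state k (restrict (\<lambda>p. ?X p \<omega>) ?I)" for \<omega>
    by (rule state_cong) auto
  have "indep_var ?Q (\<lambda>\<omega>. restrict (\<lambda>p. ?X p \<omega>) ?I)
      (PiM {(k, i)} (\<lambda>_. borel)) (\<lambda>\<omega>. restrict (\<lambda>p. ?X p \<omega>) {(k, i)})"
    using i by (intro indep_var_restrict[OF \<Delta>_indep]) auto
  from indep_var_compose_law[OF this F measurable_component_singleton[of "(k, i)"]]
  show ?thesis
    by (simp add: o.v_def o.x_def o.y_def v_def x_def y_def state)
qed

lemma noise_prob: "prob_space (noise \<eta>)"
  using \<Delta>_law[of 1 0] \<Delta>_measurable[of 1 0] m_pos prob_space_distr[of "\<Delta> 0 1" borel] by simp

lemma sets_noise [measurable_cong]: "sets (noise \<eta>) = sets borel"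
  by (simp add: noise_def)

text \<open>
  One bound for both \<open>K\<close> and the gradients of \<open>f\<close> on \<open>K\<close>. The oracle answers, the errors and the
  vectors \<open>z\<^sub>k\<close> are bounded by multiples of it, which settles integrability.
\<close>

definition K_bound :: real where
  "K_bound = (SOME B. \<forall>u\<in>K. norm u \<le> B \<and> norm (grad f u) \<le> B)"

lemma K_bound: "u \<in> K \<Longrightarrow> norm u \<le> K_bound" "u \<in> K \<Longrightarrow> norm (grad f u) \<le> K_bound"
proof -
  obtain B where B: "\<And>u. u \<in> K \<Longrightarrow> norm u \<le> B"
    using compact_imp_bounded[OF K_compact] by (auto simp: bounded_iff)
  have "compact (grad f ` K)"
    by (intro compact_continuous_image K_compact continuous_on_subset[OF grad_f_continuous]) simp
  then obtain B' where B': "\<And>u. u \<in> K \<Longrightarrow> norm (grad f u) \<le> B'"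
    using compact_imp_bounded by (force simp: bounded_iff)
  have "\<exists>B. \<forall>u\<in>K. norm u \<le> B \<and> norm (grad f u) \<le> B"
    using B B' by (intro exI[of _ "max B B'"]) (auto simp: le_max_iff_disj)
  from someI_ex[OF this, folded K_bound_def]
  show "u \<in> K \<Longrightarrow> norm u \<le> K_bound" "u \<in> K \<Longrightarrow> norm (grad f u) \<le> K_bound" by auto
qed

lemma K_bound_nonneg: "K_bound \<ge> 0"
  using K_bound(1)[OF x0_in] norm_ge_zero order_trans by blast

lemma norm_grad_f_x: "norm (grad f (x k \<omega>)) \<le> K_bound"
  by (rule K_bound(2)[OF x_in])

lemma lmo_noise_integrable: "integrable (noise \<eta>) (\<lambda>\<zeta>. lmo (w + \<alpha> *\<^sub>R \<zeta>))"
proof -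
  interpret n: prob_space "noise \<eta>" by (rule noise_prob)
  show ?thesis
    by (rule n.integrable_const_bound[where B = K_bound]) (auto intro: K_bound lmo_in)
qed

lemma grad_G_eq: "grad G w = - (\<integral>\<zeta>. lmo (- w + \<alpha> *\<^sub>R \<zeta>) \<partial>noise \<eta>)"
  by (simp add: grad_G smoothed_grad[OF \<alpha>_pos])

lemma norm_grad_G: "norm (grad G w) \<le> K_bound"
proof -
  interpret n: prob_space "noise \<eta>" by (rule noise_prob)
  have "norm (\<integral>\<zeta>. lmo (- w + \<alpha> *\<^sub>R \<zeta>) \<partial>noise \<eta>) \<le> (\<integral>\<zeta>. norm (lmo (- w + \<alpha> *\<^sub>R \<zeta>)) \<partial>noise \<eta>)"
    by (rule integral_norm_bound)
  also have "\<dots> \<le> K_bound"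
    by (intro n.integral_le_const integrable_norm lmo_noise_integrable) (auto intro: K_bound lmo_in)
  finally show ?thesis by (simp add: grad_G_eq)
qed

lemma norm_noise_err: "norm (noise_err k \<omega>) \<le> 2 * K_bound"
  using norm_triangle_ineq4[of "g k \<omega>" "grad G (v k \<omega>)"] norm_grad_G[of "v k \<omega>"]
    K_bound(1)[OF minus_g_in, of k \<omega>]
  by (simp add: noise_err_def)

lemma noise_err_sq_integrable: "integrable P (\<lambda>\<omega>. (dual_norm N (noise_err k \<omega>))\<^sup>2)"
proof -
  obtain c C where C: "c > 0" "C > 0"
    "\<forall>z. c * norm z \<le> dual_norm N z \<and> dual_norm N z \<le> C * norm z"
    using is_norm_equivalent[OF dual_norm_is_norm] by blast
  have "(dual_norm N (noise_err k \<omega>))\<^sup>2 \<le> (C * (2 * K_bound))\<^sup>2" for \<omega>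
  proof (rule power_mono)
    have "dual_norm N (noise_err k \<omega>) \<le> C * norm (noise_err k \<omega>)" using C(3) by blast
    also have "\<dots> \<le> C * (2 * K_bound)"
      using C(2) by (intro mult_left_mono norm_noise_err) simp
    finally show "dual_norm N (noise_err k \<omega>) \<le> C * (2 * K_bound)" .
  qed (rule is_norm_nonneg[OF dual_norm_is_norm])
  then show ?thesis
    by (intro integrable_const_bound[where B = "(C * (2 * K_bound))\<^sup>2"]) auto
qed

lemma noise_err_inner_integrable: "integrable P (\<lambda>\<omega>. noise_err k \<omega> \<bullet> grad f (x k \<omega>))"
proof (rule integrable_const_bound[where B = "2 * K_bound * K_bound"])
  have "\<bar>noise_err k \<omega> \<bullet> grad f (x k \<omega>)\<bar> \<le> 2 * K_bound * K_bound" for \<omega>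
    using Cauchy_Schwarz_ineq2 mult_mono[OF norm_noise_err norm_grad_f_x] K_bound_nonneg
    by (smt (verit) norm_ge_zero)
  then show "AE \<omega> in P. norm (noise_err k \<omega> \<bullet> grad f (x k \<omega>)) \<le> 2 * K_bound * K_bound"
    by simp
qed measurable

text \<open>
  With the past held fixed, averaging one sample over its perturbation gives the gradient of \<open>G\<close>, up
  to sign. Pairing with \<open>z\<^sub>k\<close> turns this into a statement about real-valued expectations.
\<close>

lemma oracle_unbiased:
  assumes i: "i \<in> {1..m}"
  shows "integrable P (\<lambda>\<omega>. lmo (- v k \<omega> + \<alpha> *\<^sub>R \<Delta> k i \<omega>) \<bullet> grad f (x k \<omega>))"
    and "expectation (\<lambda>\<omega>. lmo (- v k \<omega> + \<alpha> *\<^sub>R \<Delta> k i \<omega>) \<bullet> grad f (x k \<omega>))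
      = expectation (\<lambda>\<omega>. - grad G (v k \<omega>) \<bullet> grad f (x k \<omega>))"
proof -
  note \<Delta>_measurable[OF i, measurable]
  define h where "h p = lmo (- fst (fst p) + \<alpha> *\<^sub>R snd p) \<bullet> snd (fst p)"
    for p :: "('a \<times> 'a) \<times> 'a"
  have h: "h \<in> borel_measurable ((borel \<Otimes>\<^sub>M borel) \<Otimes>\<^sub>M borel)"
    unfolding h_def[abs_def] by measurable
  have "\<bar>lmo (- v k \<omega> + \<alpha> *\<^sub>R \<Delta> k i \<omega>) \<bullet> grad f (x k \<omega>)\<bar> \<le> K_bound * K_bound" for \<omega>
    using Cauchy_Schwarz_ineq2 mult_mono[OF K_bound(1)[OF lmo_in] norm_grad_f_x] K_bound_nonneg
    by (smt (verit) norm_ge_zero)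
  then show int: "integrable P (\<lambda>\<omega>. lmo (- v k \<omega> + \<alpha> *\<^sub>R \<Delta> k i \<omega>) \<bullet> grad f (x k \<omega>))"
    by (intro integrable_const_bound[where B = "K_bound * K_bound"]) auto
  have inner: "(\<integral>\<zeta>. lmo (- w + \<alpha> *\<^sub>R \<zeta>) \<bullet> z \<partial>noise \<eta>) = - grad G w \<bullet> z" for w z
    unfolding grad_G_eq minus_minus by (rule integral_inner_left[OF lmo_noise_integrable])
  show "expectation (\<lambda>\<omega>. lmo (- v k \<omega> + \<alpha> *\<^sub>R \<Delta> k i \<omega>) \<bullet> grad f (x k \<omega>))
      = expectation (\<lambda>\<omega>. - grad G (v k \<omega>) \<bullet> grad f (x k \<omega>))"
    using expectation_freeze[OF _ _ indep_past[OF i] h]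
    unfolding h_def fst_conv snd_conv \<Delta>_law[OF i] inner
    using int by simp
qed

lemma expectation_noise_err_inner: "expectation (\<lambda>\<omega>. noise_err k \<omega> \<bullet> grad f (x k \<omega>)) = 0"
proof -
  let ?l = "\<lambda>i \<omega>. lmo (- v k \<omega> + \<alpha> *\<^sub>R \<Delta> k i \<omega>) \<bullet> grad f (x k \<omega>)"
  let ?b = "\<lambda>\<omega>. - grad G (v k \<omega>) \<bullet> grad f (x k \<omega>)"
  have eq: "?b \<omega> = noise_err k \<omega> \<bullet> grad f (x k \<omega>) + (1 / real m) * (\<Sum>i=1..m. ?l i \<omega>)" for \<omega>
    by (simp add: noise_err_def g_def oracle_mean_def inner_diff_left inner_sum_left sum_negf)
  have l: "integrable P (\<lambda>\<omega>. \<Sum>i=1..m. ?l i \<omega>)"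
    by (rule Bochner_Integration.integrable_sum) (rule oracle_unbiased(1))
  have "expectation ?b = expectation (\<lambda>\<omega>. noise_err k \<omega> \<bullet> grad f (x k \<omega>))
      + (1 / real m) * expectation (\<lambda>\<omega>. \<Sum>i=1..m. ?l i \<omega>)"
    unfolding eq
    by (subst Bochner_Integration.integral_add)
      (use noise_err_inner_integrable l in \<open>simp_all only: integrable_mult_right integral_mult_right_zero\<close>)
  also have "expectation (\<lambda>\<omega>. \<Sum>i=1..m. ?l i \<omega>) = (\<Sum>i=1..m. expectation (?l i))"
    by (rule Bochner_Integration.integral_sum) (rule oracle_unbiased(1))
  also have "(\<Sum>i=1..m. expectation (?l i)) = (\<Sum>i=1..m. expectation ?b)"
    using oracle_unbiased(2) by (intro sum.cong) auto
  finally show ?thesis using m_pos by simp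
qed

text \<open>
  A conditional expectation has the same integral as the variable itself, so the conditional
  variance bound can be integrated.
\<close>

lemma expectation_noise_err_sq:
  "expectation (\<lambda>\<omega>. (dual_norm N (noise_err k \<omega>))\<^sup>2) \<le> 4 * R\<^sup>2 * \<rho> / real m"
proof -
  let ?F = "past P k"
  have gen: "{\<Delta> j i -` B \<inter> space P | j i B. j < k \<and> i \<in> {1..m} \<and> B \<in> sets borel} \<subseteq> sets P"
    using \<Delta>_measurable by (auto intro: measurable_sets)
  then have "sets ?F \<subseteq> sets P"
    unfolding past_def
    by (subst sets_measure_of) (auto simp del: atLeastAtMost_iff intro!: sets.sigma_sets_subset)
  then have "subalgebra P ?F" by (simp add: subalgebra_def past_def space_measure_of_conv)
  then interpret F: finite_measure_subalgebra P ?F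
    by unfold_locales
  let ?h = "\<lambda>\<omega>. (dual_norm N (noise_err k \<omega>))\<^sup>2"
  have "expectation ?h = expectation (real_cond_exp P ?F ?h)"
    using F.real_cond_exp_int(2)[OF noise_err_sq_integrable] by simp
  also have "\<dots> \<le> 4 * R\<^sup>2 * \<rho> / real m"
    using variance_bound[of k] F.real_cond_exp_int(1)[OF noise_err_sq_integrable]
    by (intro integral_le_const) (auto simp: noise_err_def)
  finally show ?thesis .
qed

lemma step_err_integrable: "integrable P (step_err k)"
  unfolding step_err_def[abs_def] using noise_err_sq_integrable noise_err_inner_integrable by simp

text \<open>
  The second bound in the definition of \<open>\<alpha>\<close> makes the reserve in the weights large enough for the
  noise to cost at most \<open>\<epsilon>/3\<close> per unit of weight.
\<close>

lemma sqrt_\<mu>_\<beta>_ge: "sqrt (\<mu> * \<beta>) \<ge> 6 * R\<^sup>2 * \<rho> / (real m * \<epsilon>)"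
proof (rule real_le_rsqrt)
  have pos: "0 < L" "0 < R" "0 < M" "0 < \<rho>" "0 < \<epsilon>" "0 < real m"
    using L_pos R_pos M_pos \<rho>_pos \<epsilon>_pos m_pos by auto
  have "\<alpha> \<le> M * \<epsilon>\<^sup>2 * (real m)\<^sup>2 / (36 * L * R ^ 3 * \<rho>\<^sup>2)"
    unfolding \<alpha>_def smoothing_param_def by simp
  then have "R * M / (L * (M * \<epsilon>\<^sup>2 * (real m)\<^sup>2 / (36 * L * R ^ 3 * \<rho>\<^sup>2))) \<le> R * M / (L * \<alpha>)"
    using pos \<alpha>_pos by (intro divide_left_mono mult_left_mono) auto
  moreover have "R * M / (L * (M * \<epsilon>\<^sup>2 * (real m)\<^sup>2 / (36 * L * R ^ 3 * \<rho>\<^sup>2)))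
      = (6 * R\<^sup>2 * \<rho> / (real m * \<epsilon>))\<^sup>2"
    using pos by (simp add: field_simps power2_eq_square power3_eq_cube)
  ultimately show "(6 * R\<^sup>2 * \<rho> / (real m * \<epsilon>))\<^sup>2 \<le> \<mu> * \<beta>"
    by (simp add: \<mu>_def \<beta>_def)
qed

lemma expectation_step_err: "expectation (step_err k) \<le> \<epsilon> / 3"
proof -
  let ?r = "sqrt (\<mu> * \<beta>)" and ?c = "6 * R\<^sup>2 * \<rho> / (real m * \<epsilon>)"
  have pos: "0 < R" "0 < \<rho>" "0 < \<epsilon>" "0 < real m" using R_pos \<rho>_pos \<epsilon>_pos m_pos by auto
  then have c: "?c > 0" by simp
  then have r: "?r > 0" using sqrt_\<mu>_\<beta>_ge by linarith
  have "expectation (step_err k) = expectation (\<lambda>\<omega>. (dual_norm N (noise_err k \<omega>))\<^sup>2) / (2 * ?r)"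
    unfolding step_err_def[abs_def]
    using noise_err_sq_integrable noise_err_inner_integrable
    by (simp add: expectation_noise_err_inner)
  also have "\<dots> \<le> (4 * R\<^sup>2 * \<rho> / real m) / (2 * ?r)"
    using r by (intro divide_right_mono expectation_noise_err_sq) simp
  also have "\<dots> \<le> (4 * R\<^sup>2 * \<rho> / real m) / (2 * ?c)"
    using r c pos sqrt_\<mu>_\<beta>_ge by (intro divide_left_mono) auto
  also have "\<dots> = \<epsilon> / 3" using pos by (simp add: field_simps)
  finally show ?thesis .
qed

lemma gap_measurable [measurable]: "gap k \<in> borel_measurable P"
  unfolding gap_eq[abs_def] f_conj_def support_fun_lmo by measurable

lemma expectation_gap:
  assumes "k \<ge> 1"
  shows "integrable P (gap k)"
    and "A k * expectation (gap k) \<le> \<beta> * (f x0 - f x_star) + A k * (2 * \<epsilon> / 3)"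
proof -
  let ?S = "\<lambda>\<omega>. \<Sum>i<k. (A (Suc i) - A i) * step_err i \<omega>"
  let ?U = "\<lambda>\<omega>. \<beta> * (f x0 - f x_star) + A k * (\<alpha> * s1) + ?S \<omega>"
  have A: "A k > 0" using assms A_Suc_pos[of "k - 1"] by simp
  have S: "integrable P ?S" using step_err_integrable by simp
  have "integrable P (\<lambda>\<omega>. A k * gap k \<omega>)"
  proof (rule Bochner_Integration.integrable_bound)
    show "integrable P ?U" using S by simp
    have "norm (A k * gap k \<omega>) \<le> norm (?U \<omega>)" for \<omega>
      using gap_bound[of k \<omega>] mult_nonneg_nonneg[OF A_nonneg gap_nonneg, of k k \<omega>]
      unfolding real_norm_def by linarith
    then show "AE \<omega> in P. norm (A k * gap k \<omega>) \<le> norm (?U \<omega>)" by simp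
  qed measurable
  with A show int: "integrable P (gap k)" by simp
  have "A k * expectation (gap k) = expectation (\<lambda>\<omega>. A k * gap k \<omega>)" by simp
  also have "\<dots> \<le> expectation ?U"
    using S int gap_bound by (intro integral_mono) auto
  also have "\<dots> = \<beta> * (f x0 - f x_star) + A k * (\<alpha> * s1)
      + (\<Sum>i<k. (A (Suc i) - A i) * expectation (step_err i))"
    using step_err_integrable by (simp add: prob_space)
  also have "(\<Sum>i<k. (A (Suc i) - A i) * expectation (step_err i)) \<le> (\<Sum>i<k. (A (Suc i) - A i) * (\<epsilon> / 3))"
    by (intro sum_mono mult_left_mono expectation_step_err) (use A_less in \<open>auto intro: less_imp_le\<close>)
  also have "\<dots> = A k * (\<epsilon> / 3)"
    by (simp only: sum_distrib_right[symmetric] sum_lessThan_telescope A_0 diff_zero)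
  also have "A k * (\<alpha> * s1) \<le> A k * (\<epsilon> / 3)"
  proof (rule mult_left_mono)
    have "\<alpha> \<le> \<epsilon> / (3 * s1)" unfolding \<alpha>_def smoothing_param_def by simp
    then show "\<alpha> * s1 \<le> \<epsilon> / 3" using s1_pos by (simp add: field_simps)
  qed (use A in simp)
  finally show "A k * expectation (gap k) \<le> \<beta> * (f x0 - f x_star) + A k * (2 * \<epsilon> / 3)"
    by (simp add: algebra_simps)
qed

text \<open>
  The threshold is exactly the number of steps after which the geometric lower bound for \<open>A\<^sub>k\<close>
  reaches \<open>3 \<beta> (f(x\<^sub>0) - f(x\<^sub>\<star>)) / \<epsilon>\<close>. If \<open>x\<^sub>0\<close> is already optimal, no growth is called for.
\<close>

lemma A_large:
  assumes k: "k \<ge> 1" "real k \<ge> iteration_threshold L R M s1 \<rho> (f x0 - f x_star) m \<epsilon>"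
  shows "\<beta> * (f x0 - f x_star) \<le> A k * (\<epsilon> / 3)"
proof (cases "f x0 = f x_star")
  case True
  then show ?thesis using A_nonneg[of k] \<epsilon>_pos by simp
next
  case False
  define D where "D = f x0 - f x_star"
  have D: "D > 0" using False f_x_star_le[OF x0_in] by (simp add: D_def)
  define q where "q = sqrt (\<mu> / \<beta>)"
  define c where "c = 6 * L * R * M * D / (\<epsilon> * \<alpha>)"
  have pos: "0 < L" "0 < R" "0 < M" "0 < \<epsilon>" "0 < \<alpha>"
    using L_pos R_pos M_pos \<epsilon>_pos \<alpha>_pos by auto
  have c: "c > 0" "c = 6 * \<beta> * D / (\<epsilon> * \<mu>)"
    using pos D by (auto simp: c_def \<beta>_def \<mu>_def mult_ac)
  have q: "q > 0" using \<mu>_pos \<beta>_pos by (simp add: q_def)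
  have "sqrt (L * R * M) / sqrt \<alpha> = sqrt (\<beta> / \<mu>)"
    by (simp add: \<beta>_def \<mu>_def real_sqrt_divide[symmetric] mult_ac)
  also have "\<dots> = 1 / q" by (simp add: q_def real_sqrt_divide)
  finally have rate: "8 * sqrt (L * R * M) / sqrt \<alpha> = 8 / q" by simp
  have "iteration_threshold L R M s1 \<rho> D m \<epsilon> = 1 + 8 * sqrt (L * R * M) / sqrt \<alpha> * ln c"
    unfolding iteration_threshold_def \<alpha>_def[symmetric] Let_def c_def ..
  then have "1 + 8 / q * ln c \<le> real k"
    using k(2) unfolding rate D_def by simp
  then have "ln c \<le> real (k - 1) * q / 8"
    using q k(1) by (simp add: of_nat_diff field_simps)
  then have "c \<le> exp (real (k - 1) * q / 8)"
    using c(1) by (metis exp_le_cancel_iff exp_ln)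
  then have "\<mu> / 2 * c \<le> \<mu> / 2 * exp (real (k - 1) * q / 8)"
    using \<mu>_pos by simp
  also have "\<dots> \<le> A k"
    using weight_seq_lower_bound[OF \<mu>_pos \<mu>_le_\<beta>, of "k - 1"] k(1) by (simp add: A_def q_def)
  finally have "\<mu> / 2 * c * (\<epsilon> / 3) \<le> A k * (\<epsilon> / 3)"
    using pos by (intro mult_right_mono) auto
  moreover have "\<mu> / 2 * c * (\<epsilon> / 3) = \<beta> * D"
    unfolding c(2) using pos \<mu>_pos by (simp add: field_simps)
  ultimately show ?thesis by (simp only: D_def)
qed

theorem gap_achieved_of_threshold:
  assumes k: "k \<ge> 1" "real k \<ge> iteration_threshold L R M s1 \<rho> (f x0 - f x_star) m \<epsilon>"
  shows "gap_achieved P k"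
proof -
  have A: "A k > 0" using k(1) A_Suc_pos[of "k - 1"] by simp
  have "A k * expectation (gap k) \<le> A k * \<epsilon>"
    using expectation_gap(2)[OF k(1)] A_large[OF k] by simp
  then have "expectation (gap k) \<le> \<epsilon>" using A by simp
  then show ?thesis
    using expectation_gap(1)[OF k(1)]
    unfolding gap_achieved_def gap_def[abs_def] by (simp add: dual_obj_y)
qed

end

section \<open>The size of the threshold\<close>

text \<open>
  Each of the two bounds in \<open>\<alpha>\<close> is at least a constant multiple of \<open>1/T\<^sup>2\<close>: the first because
  \<open>1/\<epsilon> \<le> T\<^sup>2\<close>, the second because \<open>1/(\<epsilon>m)\<^sup>2 \<le> T\<^sup>2\<close>.
\<close>

lemma smoothing_param_ge:
  assumes pos: "L > 0" "R > 0" "M > 0" "s1 > 0" "\<rho> > 0" "\<epsilon> > 0" "m \<ge> 1"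
  defines "h \<equiv> 3 * s1 + 36 * L * R ^ 3 * \<rho>\<^sup>2 / M" and "T \<equiv> max (1 / sqrt \<epsilon>) (1 / (\<epsilon> * real m))"
  shows "smoothing_param L R M s1 \<rho> m \<epsilon> \<ge> 1 / (h * T\<^sup>2)"
proof -
  define b where "b = 36 * L * R ^ 3 * \<rho>\<^sup>2 / M"
  have b: "b > 0" and h: "h = 3 * s1 + b" using pos by (simp_all add: b_def h_def)
  have m: "real m > 0" using pos(7) by simp
  have T: "T > 0" using pos by (simp add: T_def less_max_iff_disj)
  have "(1 / sqrt \<epsilon>)\<^sup>2 \<le> T\<^sup>2" "(1 / (\<epsilon> * real m))\<^sup>2 \<le> T\<^sup>2"
    using pos by (auto intro!: power_mono simp: T_def)
  then have T2: "1 / \<epsilon> \<le> T\<^sup>2" "1 / (\<epsilon>\<^sup>2 * (real m)\<^sup>2) \<le> T\<^sup>2"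
    using pos by (simp_all add: power_divide power_mult_distrib)
  have le: "1 / (h * T\<^sup>2) \<le> u" if "u > 0" "1 / u \<le> h * T\<^sup>2" for u
    using le_imp_inverse_le[of "1 / u" "h * T\<^sup>2"] that by (simp add: inverse_eq_divide)
  have "1 / (h * T\<^sup>2) \<le> \<epsilon> / (3 * s1)"
  proof (rule le)
    have "1 / (\<epsilon> / (3 * s1)) = 3 * s1 * (1 / \<epsilon>)" by simp
    also have "\<dots> \<le> h * T\<^sup>2" using T2 h b pos by (intro mult_mono) auto
    finally show "1 / (\<epsilon> / (3 * s1)) \<le> h * T\<^sup>2" .
  qed (use pos in simp)
  moreover have "1 / (h * T\<^sup>2) \<le> M * \<epsilon>\<^sup>2 * (real m)\<^sup>2 / (36 * L * R ^ 3 * \<rho>\<^sup>2)"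
  proof (rule le)
    have "1 / (M * \<epsilon>\<^sup>2 * (real m)\<^sup>2 / (36 * L * R ^ 3 * \<rho>\<^sup>2)) = b * (1 / (\<epsilon>\<^sup>2 * (real m)\<^sup>2))"
      by (simp add: b_def)
    also have "\<dots> \<le> h * T\<^sup>2" using T2 h b pos by (intro mult_mono) auto
    finally show "1 / (M * \<epsilon>\<^sup>2 * (real m)\<^sup>2 / (36 * L * R ^ 3 * \<rho>\<^sup>2)) \<le> h * T\<^sup>2" .
  qed (use pos m in simp)
  ultimately show ?thesis by (simp add: smoothing_param_def)
qed

text \<open>
  For small \<open>\<epsilon>\<close> one has \<open>T \<le> 1/\<epsilon>\<close>, so the argument of the logarithm is at most a constant times
  \<open>1/\<epsilon>\<^sup>3\<close>; the fourth power of \<open>1/\<epsilon>\<close> also swallows the constant.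
\<close>

lemma iteration_threshold_le:
  assumes pos: "L > 0" "R > 0" "M > 0" "s1 > 0" "\<rho> > 0" "\<epsilon> > 0" "m \<ge> 1" "D \<ge> 0"
  defines "h \<equiv> 3 * s1 + 36 * L * R ^ 3 * \<rho>\<^sup>2 / M" and "T \<equiv> max (1 / sqrt \<epsilon>) (1 / (\<epsilon> * real m))"
  assumes small: "\<epsilon> \<le> 1" "6 * L * R * M * D * h * \<epsilon> \<le> 1"
  shows "iteration_threshold L R M s1 \<rho> D m \<epsilon> \<le> 1 + 32 * sqrt (L * R * M) * sqrt h * T * ln (1 / \<epsilon>)"
proof -
  define a where "a = smoothing_param L R M s1 \<rho> m \<epsilon>"
  have h: "h > 0" using pos by (simp add: h_def add_pos_pos)
  have m: "real m \<ge> 1" using pos(7) by simp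
  have T: "T > 0" using pos by (simp add: T_def less_max_iff_disj)
  have a_ge: "1 / (h * T\<^sup>2) \<le> a"
    unfolding a_def h_def T_def by (rule smoothing_param_ge[OF pos(1-7)])
  have a: "a > 0" by (rule less_le_trans[OF _ a_ge]) (use h T in simp)
  have inv_a: "1 / a \<le> h * T\<^sup>2" using a_ge a h T by (simp add: field_simps)
  have "1 / sqrt a = sqrt (1 / a)" by (simp add: real_sqrt_divide)
  also have "\<dots> \<le> sqrt (h * T\<^sup>2)" using inv_a by simp
  also have "\<dots> = sqrt h * T" using T by (simp add: real_sqrt_mult)
  finally have root: "1 / sqrt a \<le> sqrt h * T" .
  have T_le: "T \<le> 1 / \<epsilon>"
  proof -
    have "\<epsilon>\<^sup>2 \<le> \<epsilon>" using pos small by (simp add: power2_eq_square mult_left_le)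
    then have "\<epsilon> \<le> sqrt \<epsilon>" by (rule real_le_rsqrt)
    then have "1 / sqrt \<epsilon> \<le> 1 / \<epsilon>" using pos by (intro divide_left_mono) auto
    moreover have "1 / (\<epsilon> * real m) \<le> 1 / \<epsilon>" using pos m by (intro divide_left_mono) auto
    ultimately show ?thesis by (simp add: T_def)
  qed
  have l: "ln (1 / \<epsilon>) \<ge> 0" using pos small by simp
  have log: "ln (6 * L * R * M * D / (\<epsilon> * a)) \<le> 4 * ln (1 / \<epsilon>)"
  proof (cases "D = 0")
    case True
    then show ?thesis using l by simp
  next
    case False
    define c where "c = 6 * L * R * M * D"
    have c: "c > 0" using pos False by (simp add: c_def)
    have "T\<^sup>2 \<le> (1 / \<epsilon>)\<^sup>2" using T T_le by (intro power_mono) auto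
    then have "1 / a \<le> h * (1 / \<epsilon>)\<^sup>2" using inv_a h by (smt (verit) mult_left_mono)
    then have "c / \<epsilon> * (1 / a) \<le> c / \<epsilon> * (h * (1 / \<epsilon>)\<^sup>2)" using c pos by (intro mult_left_mono) auto
    also have "\<dots> = (c * h * \<epsilon>) * (1 / \<epsilon>) ^ 4" using pos by (simp add: field_simps power2_eq_square power4_eq_xxxx)
    also have "\<dots> \<le> 1 * (1 / \<epsilon>) ^ 4" using small(2) pos by (intro mult_right_mono) (auto simp: c_def)
    finally have "c / (\<epsilon> * a) \<le> (1 / \<epsilon>) ^ 4" by simp
    then have "ln (c / (\<epsilon> * a)) \<le> ln ((1 / \<epsilon>) ^ 4)" using c pos a by (subst ln_le_cancel_iff) auto
    also have "\<dots> = 4 * ln (1 / \<epsilon>)" using pos by (simp add: ln_realpow)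
    finally show ?thesis by (simp add: c_def)
  qed
  let ?s = "8 * sqrt (L * R * M)"
  have "iteration_threshold L R M s1 \<rho> D m \<epsilon> = 1 + ?s * (1 / sqrt a) * ln (6 * L * R * M * D / (\<epsilon> * a))"
    by (simp add: iteration_threshold_def Let_def a_def)
  also have "\<dots> \<le> 1 + ?s * (1 / sqrt a) * (4 * ln (1 / \<epsilon>))"
    using log pos a by (intro add_left_mono mult_left_mono) auto
  also have "\<dots> \<le> 1 + ?s * (sqrt h * T) * (4 * ln (1 / \<epsilon>))"
    using root pos l by (intro add_left_mono mult_right_mono mult_left_mono) auto
  finally show ?thesis by (simp add: mult_ac)
qed

text \<open>
  The additive constant 2 in the witness covers the leading 1 of the threshold and the rounding up
  to an integer; it is absorbed because \<open>T\<close> and \<open>log (1/\<epsilon>)\<close> are at least one for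
  \<open>\<epsilon> < 1/e\<close>.
\<close>

lemma iteration_threshold_rate:
  assumes pos: "L > 0" "R > 0" "M > 0" "s1 > 0" "\<rho> > 0" "D \<ge> 0"
  shows "\<exists>C>0. \<forall>\<^sub>F \<epsilon> in at_right 0. \<forall>m\<ge>1. \<exists>n\<ge>1.
    iteration_threshold L R M s1 \<rho> D m \<epsilon> \<le> real n \<and>
    real n \<le> C * max (1 / sqrt \<epsilon>) (1 / (\<epsilon> * real m)) * ln (1 / \<epsilon>)"
proof -
  define h where "h = 3 * s1 + 36 * L * R ^ 3 * \<rho>\<^sup>2 / M"
  define w where "w = 6 * L * R * M * D * h"
  define c where "c = 32 * sqrt (L * R * M) * sqrt h"
  define e where "e = min (exp (-1)) (1 / (w + 1))"
  have h: "h > 0" using pos by (simp add: h_def add_pos_pos)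
  have w: "w \<ge> 0" using pos h by (simp add: w_def)
  have c: "c \<ge> 0" using pos h by (simp add: c_def)
  have e: "e > 0" using w by (simp add: e_def)
  show ?thesis
  proof (intro exI[of _ "2 + c"] conjI)
    show "2 + c > 0" using c by simp
    have "\<exists>n\<ge>1. iteration_threshold L R M s1 \<rho> D m \<epsilon> \<le> real n \<and>
        real n \<le> (2 + c) * max (1 / sqrt \<epsilon>) (1 / (\<epsilon> * real m)) * ln (1 / \<epsilon>)"
      if \<epsilon>: "0 < \<epsilon>" "\<epsilon> < e" and m: "m \<ge> 1" for \<epsilon> m
    proof -
      let ?T = "max (1 / sqrt \<epsilon>) (1 / (\<epsilon> * real m))" and ?l = "ln (1 / \<epsilon>)"
      let ?t = "iteration_threshold L R M s1 \<rho> D m \<epsilon>"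
      have e1: "\<epsilon> < exp (-1)" "\<epsilon> * (w + 1) < 1" using \<epsilon> w by (auto simp: e_def field_simps)
      then have \<epsilon>1: "\<epsilon> \<le> 1" using exp_le_one_iff[of "-1"] by linarith
      have "ln \<epsilon> < ln (exp (-1))" using e1(1) \<epsilon>(1) by (subst ln_less_cancel_iff) auto
      then have l: "?l \<ge> 1" using \<epsilon>(1) by (simp add: ln_div)
      have T: "?T \<ge> 1" using \<epsilon>(1) \<epsilon>1 by (simp add: le_max_iff_disj)
      have Tl: "?T * ?l \<ge> 1" using mult_mono[OF T l] T by simp
      have "?t \<le> 1 + c * ?T * ?l"
        unfolding c_def h_def
        by (rule iteration_threshold_le) (use pos \<epsilon>(1) m \<epsilon>1 e1(2) in \<open>simp_all add: w_def h_def algebra_simps\<close>)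
      moreover have "c * ?T * ?l \<ge> 0" using c T l by simp
      ultimately have "max 1 ?t \<le> 1 + c * ?T * ?l" by simp
      moreover have "1 + (1 + c * ?T * ?l) \<le> (2 + c) * ?T * ?l"
        using Tl by (simp add: algebra_simps)
      ultimately have up: "max 1 ?t + 1 \<le> (2 + c) * ?T * ?l" by linarith
      define n where "n = nat \<lceil>max 1 ?t\<rceil>"
      have n: "max 1 ?t \<le> real n" "real n \<le> max 1 ?t + 1"
        unfolding n_def using real_nat_ceiling_ge of_int_ceiling_le_add_one[of "max 1 ?t"]
        by (auto simp: of_nat_nat)
      show ?thesis using n up by (intro exI[of _ n]) auto
    qed
    then show "\<forall>\<^sub>F \<epsilon> in at_right 0. \<forall>m\<ge>1. \<exists>n\<ge>1. iteration_threshold L R M s1 \<rho> D m \<epsilon> \<le> real n \<and>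
        real n \<le> (2 + c) * max (1 / sqrt \<epsilon>) (1 / (\<epsilon> * real m)) * ln (1 / \<epsilon>)"
      by (intro eventually_at_rightI[OF _ e]) simp
  qed
qed

section \<open>The iteration complexity\<close>

theorem theorem3:
  shows
    "(\<forall>(N :: 'a::euclidean_space \<Rightarrow> real) K f L x0 \<eta> lmo \<rho> m \<epsilon> \<Delta> (P :: 'w measure) x_star.
        parallel_fw N K f L x0 \<eta> lmo \<rho> m \<epsilon> \<Delta> P x_star \<longrightarrow>
        (\<forall>k\<ge>1.
           real k \<ge> iteration_threshold L (dual_radius N K) (noise_const N \<eta>)
                      (smoothed_support K \<eta> 1 0) \<rho> (f x0 - f x_star) m \<epsilon> \<longrightarrow>
           parallel_fw_data.gap_achieved N K f L x0 \<eta> lmo \<rho> m \<epsilon> \<Delta> P k))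
     \<and>
     (\<forall>L R M \<rho> s1 D :: real.
        L > 0 \<and> R > 0 \<and> M > 0 \<and> \<rho> > 0 \<and> s1 > 0 \<and> D \<ge> 0 \<longrightarrow>
        (\<exists>C>0. \<exists>p::nat. \<forall>\<^sub>F \<epsilon> in at_right 0. \<forall>m\<ge>1. \<exists>n\<ge>1.
           iteration_threshold L R M s1 \<rho> D m \<epsilon> \<le> real n \<and>
           real n \<le> C * max (1 / sqrt \<epsilon>) (1 / (\<epsilon> * real m)) * ln (1 / \<epsilon>) ^ p \<and>
           (\<forall>(N :: 'a \<Rightarrow> real) K f x0 \<eta> lmo \<Delta> (P :: 'w measure) x_star.
              parallel_fw N K f L x0 \<eta> lmo \<rho> m \<epsilon> \<Delta> P x_star \<and>
              dual_radius N K = R \<and> noise_const N \<eta> = M \<and>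
              smoothed_support K \<eta> 1 0 = s1 \<and> f x0 - f x_star = D \<longrightarrow>
              (\<forall>k\<ge>n. parallel_fw_data.gap_achieved N K f L x0 \<eta> lmo \<rho> m \<epsilon> \<Delta> P k))))"
proof (intro conjI allI impI)
  fix N :: "'a \<Rightarrow> real" and K f L x0 \<eta> lmo \<rho> m \<epsilon> and \<Delta> :: "nat \<Rightarrow> nat \<Rightarrow> 'w \<Rightarrow> 'a"
    and P :: "'w measure" and x_star k
  assume "parallel_fw N K f L x0 \<eta> lmo \<rho> m \<epsilon> \<Delta> P x_star"
  then interpret parallel_fw N K f L x0 \<eta> lmo \<rho> m \<epsilon> \<Delta> P x_star .
  assume "1 \<le> k" "iteration_threshold L (dual_radius N K) (noise_const N \<eta>)
    (smoothed_support K \<eta> 1 0) \<rho> (f x0 - f x_star) m \<epsilon> \<le> real k"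
  then show "gap_achieved P k"
    by (intro gap_achieved_of_threshold) (simp_all add: R_def M_def s1_def)
next
  fix L R M \<rho> s1 D :: real
  assume "L > 0 \<and> R > 0 \<and> M > 0 \<and> \<rho> > 0 \<and> s1 > 0 \<and> D \<ge> 0"
  then obtain C where C: "C > 0" and ev: "\<forall>\<^sub>F \<epsilon> in at_right 0. \<forall>m\<ge>1. \<exists>n\<ge>1.
      iteration_threshold L R M s1 \<rho> D m \<epsilon> \<le> real n \<and>
      real n \<le> C * max (1 / sqrt \<epsilon>) (1 / (\<epsilon> * real m)) * ln (1 / \<epsilon>)"
    using iteration_threshold_rate[of L R M s1 \<rho> D] by auto
  have achieved: "parallel_fw_data.gap_achieved N K f L x0 \<eta> lmo \<rho> m \<epsilon> \<Delta> P k"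
    if "1 \<le> n" "iteration_threshold L R M s1 \<rho> D m \<epsilon> \<le> real n" "n \<le> k"
      and fw: "parallel_fw N K f L x0 \<eta> lmo \<rho> m \<epsilon> \<Delta> P x_star"
      and params: "dual_radius N K = R" "noise_const N \<eta> = M" "smoothed_support K \<eta> 1 0 = s1"
        "f x0 - f x_star = D"
    for N :: "'a \<Rightarrow> real" and K f x0 \<eta> lmo m \<epsilon> and \<Delta> :: "nat \<Rightarrow> nat \<Rightarrow> 'w \<Rightarrow> 'a"
      and P :: "'w measure" and x_star n k
  proof -
    interpret fw: parallel_fw N K f L x0 \<eta> lmo \<rho> m \<epsilon> \<Delta> P x_star by (rule fw)
    from that show ?thesis
      by (intro fw.gap_achieved_of_threshold) (simp_all add: fw.R_def fw.M_def fw.s1_def)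
  qed
  show "\<exists>C>0. \<exists>p::nat. \<forall>\<^sub>F \<epsilon> in at_right 0. \<forall>m\<ge>1. \<exists>n\<ge>1.
      iteration_threshold L R M s1 \<rho> D m \<epsilon> \<le> real n \<and>
      real n \<le> C * max (1 / sqrt \<epsilon>) (1 / (\<epsilon> * real m)) * ln (1 / \<epsilon>) ^ p \<and>
      (\<forall>(N :: 'a \<Rightarrow> real) K f x0 \<eta> lmo \<Delta> (P :: 'w measure) x_star.
         parallel_fw N K f L x0 \<eta> lmo \<rho> m \<epsilon> \<Delta> P x_star \<and>
         dual_radius N K = R \<and> noise_const N \<eta> = M \<and>
         smoothed_support K \<eta> 1 0 = s1 \<and> f x0 - f x_star = D \<longrightarrow>
         (\<forall>k\<ge>n. parallel_fw_data.gap_achieved N K f L x0 \<eta> lmo \<rho> m \<epsilon> \<Delta> P k))"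
  proof (rule exI[of _ C], intro conjI C, rule exI[of _ "1::nat"], rule eventually_mono[OF ev],
      intro allI impI)
    fix \<epsilon> and m :: nat
    assume m: "1 \<le> m" and "\<forall>m\<ge>1. \<exists>n\<ge>1. iteration_threshold L R M s1 \<rho> D m \<epsilon> \<le> real n \<and>
      real n \<le> C * max (1 / sqrt \<epsilon>) (1 / (\<epsilon> * real m)) * ln (1 / \<epsilon>)"
    then obtain n where n: "n \<ge> 1" "iteration_threshold L R M s1 \<rho> D m \<epsilon> \<le> real n"
        "real n \<le> C * max (1 / sqrt \<epsilon>) (1 / (\<epsilon> * real m)) * ln (1 / \<epsilon>)"
      by blast
    show "\<exists>n\<ge>1. iteration_threshold L R M s1 \<rho> D m \<epsilon> \<le> real n \<and>
      real n \<le> C * max (1 / sqrt \<epsilon>) (1 / (\<epsilon> * real m)) * ln (1 / \<epsilon>) ^ 1 \<and>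
      (\<forall>(N :: 'a \<Rightarrow> real) K f x0 \<eta> lmo \<Delta> (P :: 'w measure) x_star.
         parallel_fw N K f L x0 \<eta> lmo \<rho> m \<epsilon> \<Delta> P x_star \<and>
         dual_radius N K = R \<and> noise_const N \<eta> = M \<and>
         smoothed_support K \<eta> 1 0 = s1 \<and> f x0 - f x_star = D \<longrightarrow>
         (\<forall>k\<ge>n. parallel_fw_data.gap_achieved N K f L x0 \<eta> lmo \<rho> m \<epsilon> \<Delta> P k))"
      using n achieved[OF n(1,2)] by (intro exI[of _ n] conjI allI impI) auto
  qed
qed

end
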